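(* Let $G$ be an almost connected locally compact group. Suppose that $G$ acts measurably by type-preserving simplicial isometries on a (non-empty, simplicial) tree. Then $G$ has a global fixed point in (the geometric realisation of) the tree.
   Context: A topological group $G$ with identity component $G^0$ is almost connected if $G/G^0$ is compact. A tree is regarded as a building whose chambers are the edges; its spherical residues correspond to the edges and the vertices. Type-preserving means that the action preserves each of the two classes of the bipartition of the vertex set. The action is measurable if the stabiliser in $G$ of every vertex and of every edge is Haar measurable. *)

theory Defs
  imports "HOL-Analysis.Analysis"
begin

text \<open>
  The classes \<open>topological_group_add\<close> and \<open>group_add\<close> do not assume commutativity: general
  topological groups are written additively, with \<open>0\<close> as the identity and \<open>- g\<close> as the inverse.
\<close>

definition left_cosets :: "'g::group_add set \<Rightarrow> 'g set set" where
  "left_cosets H = range (\<lambda>g. (+) g ` H)"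

definition coset_topology :: "'g::topological_group_add set \<Rightarrow> 'g set topology" where
  "coset_topology H =
     topology (\<lambda>U. U \<subseteq> left_cosets H \<and> open {g. (+) g ` H \<in> U})"

lemma openin_coset_topology:
  "openin (coset_topology H) U \<longleftrightarrow> U \<subseteq> left_cosets H \<and> open {g. (+) g ` H \<in> U}"
proof -
  have "istopology (\<lambda>U. U \<subseteq> left_cosets H \<and> open {g. (+) g ` H \<in> U})"
    unfolding istopology_def
  proof safe
    fix S T assume "open {g. (+) g ` H \<in> S}" "open {g. (+) g ` H \<in> T}"
    then have "open ({g. (+) g ` H \<in> S} \<inter> {g. (+) g ` H \<in> T})" by blast
    then show "open {g. (+) g ` H \<in> S \<inter> T}" by (simp add: Int_def)
  next
    fix \<K> assume "\<forall>K\<in>\<K>. K \<subseteq> left_cosets H \<and> open {g. (+) g ` H \<in> K}"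
    then have "open (\<Union>K\<in>\<K>. {g. (+) g ` H \<in> K})" by blast
    moreover have "(\<Union>K\<in>\<K>. {g. (+) g ` H \<in> K}) = {g. (+) g ` H \<in> \<Union>\<K>}" by blast
    ultimately show "open {g. (+) g ` H \<in> \<Union>\<K>}" by simp
  qed blast+
  then show ?thesis
    by (simp add: coset_topology_def)
qed

lemma topspace_coset_topology: "topspace (coset_topology H) = left_cosets H"
proof -
  have "openin (coset_topology H) (left_cosets H)"
    by (simp add: openin_coset_topology left_cosets_def)
  then show ?thesis
    by (meson openin_coset_topology openin_subset openin_topspace subset_antisym)
qed

lemma quotient_map_coset_topology:
  "quotient_map euclidean (coset_topology H) (\<lambda>g. (+) g ` H)"
  by (auto simp: quotient_map_def topspace_coset_topology openin_coset_topology left_cosets_def)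

definition identity_component :: "'g::topological_group_add set" where
  "identity_component = connected_component_set UNIV 0"

definition almost_connected :: "'g::topological_group_add itself \<Rightarrow> bool" where
  "almost_connected _ \<longleftrightarrow> compact_space (coset_topology (identity_component :: 'g set))"

definition left_haar_measure :: "'g::{topological_group_add, t2_space} measure \<Rightarrow> bool" where
  "left_haar_measure \<mu> \<longleftrightarrow>
     sets \<mu> = sets borel \<and>
     emeasure \<mu> UNIV \<noteq> 0 \<and>
     (\<forall>K. compact K \<longrightarrow> emeasure \<mu> K < \<infinity>) \<and>
     (\<forall>A\<in>sets borel. emeasure \<mu> A = (INF U\<in>{U. open U \<and> A \<subseteq> U}. emeasure \<mu> U)) \<and>
     (\<forall>U. open U \<longrightarrow> emeasure \<mu> U = (SUP K\<in>{K. compact K \<and> K \<subseteq> U}. emeasure \<mu> K)) \<and>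
     (\<forall>g. \<forall>A\<in>sets borel. emeasure \<mu> ((+) g ` A) = emeasure \<mu> A)"

text \<open>
  Almost connected locally compact groups are \<open>\<sigma>\<close>-compact, hence \<open>\<mu>\<close> is \<open>\<sigma>\<close>-finite
  and being measurable for the completion of \<open>\<mu>\<close> is the same as being Caratheodory measurable.
\<close>

definition haar_measurable :: "'g::{topological_group_add, t2_space} measure \<Rightarrow> 'g set \<Rightarrow> bool" where
  "haar_measurable \<mu> A \<longleftrightarrow> A \<in> sets (completion \<mu>)"

definition graph_cycle :: "'v set set \<Rightarrow> 'v list \<Rightarrow> bool" where
  "graph_cycle E xs \<longleftrightarrow>
     3 \<le> length xs \<and> distinct xs \<and>
     (\<forall>i<length xs. {xs ! i, xs ! (Suc i mod length xs)} \<in> E)"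

definition simplicial_tree :: "'v set \<Rightarrow> 'v set set \<Rightarrow> bool" where
  "simplicial_tree V E \<longleftrightarrow>
     V \<noteq> {} \<and>
     (\<forall>e\<in>E. e \<subseteq> V \<and> card e = 2) \<and>
     (\<forall>u\<in>V. \<forall>v\<in>V. (u, v) \<in> {(x, y). {x, y} \<in> E}\<^sup>*) \<and>
     (\<nexists>xs. graph_cycle E xs)"

definition simplices :: "'v set \<Rightarrow> 'v set set \<Rightarrow> 'v set set" where
  "simplices V E = (\<lambda>v. {v}) ` V \<union> E"

text \<open>Points are given by their barycentric coordinates.\<close>

definition geometric_realisation :: "'v set \<Rightarrow> 'v set set \<Rightarrow> ('v \<Rightarrow> real) set" where
  "geometric_realisation V E =
     {p. (\<forall>v. 0 \<le> p v) \<and> {v. p v \<noteq> 0} \<in> simplices V E \<and> (\<Sum>v | p v \<noteq> 0. p v) = 1}"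

text \<open>
  Each \<open>act g\<close> is an automorphism of the tree, since \<open>act (- g)\<close> is its inverse on \<open>V\<close>.
  Extended affinely to the edges, the automorphisms are exactly the simplicial isometries of
  the geometric realisation, all edges having length 1. The values of \<open>act g\<close> outside \<open>V\<close>
  are irrelevant.
\<close>

definition simplicial_action ::
    "'v set \<Rightarrow> 'v set set \<Rightarrow> ('g::group_add \<Rightarrow> 'v \<Rightarrow> 'v) \<Rightarrow> bool" where
  "simplicial_action V E act \<longleftrightarrow>
     (\<forall>g. \<forall>v\<in>V. act g v \<in> V) \<and>
     (\<forall>v\<in>V. act 0 v = v) \<and>
     (\<forall>g h. \<forall>v\<in>V. act (g + h) v = act g (act h v)) \<and>
     (\<forall>g. \<forall>e\<in>E. act g ` e \<in> E)"

definition bipartition :: "'v set \<Rightarrow> 'v set set \<Rightarrow> 'v set \<Rightarrow> 'v set \<Rightarrow> bool" where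
  "bipartition V E A B \<longleftrightarrow>
     A \<union> B = V \<and> A \<inter> B = {} \<and> (\<forall>e\<in>E. \<exists>a\<in>A. \<exists>b\<in>B. e = {a, b})"

text \<open>A tree has exactly one bipartition, up to exchanging the two classes.\<close>

definition type_preserving ::
    "'v set \<Rightarrow> 'v set set \<Rightarrow> ('g::group_add \<Rightarrow> 'v \<Rightarrow> 'v) \<Rightarrow> bool" where
  "type_preserving V E act \<longleftrightarrow>
     (\<exists>A B. bipartition V E A B \<and> (\<forall>g. act g ` A = A \<and> act g ` B = B))"

definition measurable_action ::
    "'g::{topological_group_add, t2_space} measure \<Rightarrow> 'v set \<Rightarrow> 'v set set \<Rightarrow>
      ('g \<Rightarrow> 'v \<Rightarrow> 'v) \<Rightarrow> bool" where
  "measurable_action \<mu> V E act \<longleftrightarrow>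
     (\<forall>v\<in>V. haar_measurable \<mu> {g. act g v = v}) \<and>
     (\<forall>e\<in>E. haar_measurable \<mu> {g. act g ` e = e})"

text \<open>
  The point \<open>\<Sum>v. p v \<cdot> v\<close> is moved by \<open>g\<close> to \<open>\<Sum>v. p v \<cdot> act g v\<close>, whose coordinate
  at \<open>w\<close> is \<open>p (act (- g) w)\<close>.
\<close>

definition realisation_action ::
    "'v set \<Rightarrow> ('g::group_add \<Rightarrow> 'v \<Rightarrow> 'v) \<Rightarrow> 'g \<Rightarrow> ('v \<Rightarrow> real) \<Rightarrow> 'v \<Rightarrow> real" where
  "realisation_action V act g p = (\<lambda>w. if w \<in> V then p (act (- g) w) else 0)"

end

theory Submission
  imports Defs
begin

text \<open>
  If some vertex stabiliser is not locally null, then by Steinhaus it is open, so it contains the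
  identity component and has finite index, and the centre of its finite orbit is fixed.

  Now suppose that all vertex stabilisers are locally null; then almost every translate of a
  countable set of vertices is disjoint from it. Some \<open>a\<close> fixes no vertex, since otherwise countably many
  stabilisers would cover \<open>G\<close>. Let \<open>b\<close> be a generic conjugate of \<open>a\<close>, and let \<open>S\<close> be a countable
  subtree preserved by \<open>a\<close> and \<open>b\<close>. If \<open>y\<close> moves \<open>S\<close> off itself, as almost all \<open>y\<close> do, then the bridge
  between \<open>S\<close> and \<open>y S\<close> shows that \<open>H y = [a, y] [b, y]\<close> is hyperbolic, with translation length at
  least the displacement \<open>|y|\<close> of a base vertex. Hence \<open>|(H y)\<^sup>k g| > |y|\<close> as soon as \<open>k\<close> is large
  compared with \<open>|g|\<close>. Since \<open>H 0 = 0\<close>, one can choose, as in Dudley's proof of automatic continuity,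
  exponents \<open>k n\<close>, elements \<open>g\<^sub>n\<close> and generic \<open>y\<^sub>n\<close> such that \<open>y\<^sub>n = (H y\<^bsub>n + 1\<^esub>)\<^bsup>k n\<^esup> g\<^sub>n\<close> for all \<open>n\<close>, which
  forces \<open>|y\<^sub>0| \<ge> n\<close> for all \<open>n\<close>.
\<close>

section \<open>Trees as metric spaces\<close>

text \<open>The order of the terms matters, since the group is not assumed commutative; for a
  constant sequence this is the additive form of a power.\<close>

primrec psum :: "(nat \<Rightarrow> 'g::monoid_add) \<Rightarrow> nat \<Rightarrow> 'g" where
  "psum t 0 = 0"
| "psum t (Suc n) = psum t n + t n"

text \<open>This is [a, y] [b, y], bracketed so that the factors alternate: if \<open>a\<close> and
  \<open>b\<close> preserve \<open>S\<close>, the two conjugates preserve the translate of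
  \<open>S\<close> by \<open>y\<close>.\<close>

definition commutator_product :: "'g::group_add \<Rightarrow> 'g \<Rightarrow> 'g \<Rightarrow> 'g" where
  "commutator_product a b y = a + (y + - a + - y) + b + (y + - b + - y)"

text \<open>Bipartiteness enters as \<open>dist_neighbour\<close> (adjacent vertices are never
  equidistant from a third one), acyclicity as \<open>predecessor_unique\<close>.\<close>

locale tree_metric =
  fixes V :: "'v set" and d :: "'v \<Rightarrow> 'v \<Rightarrow> nat"
  assumes dist_eq_0: "\<lbrakk>x \<in> V; y \<in> V\<rbrakk> \<Longrightarrow> d x y = 0 \<longleftrightarrow> x = y"
    and dist_sym: "\<lbrakk>x \<in> V; y \<in> V\<rbrakk> \<Longrightarrow> d x y = d y x"
    and dist_triangle: "\<lbrakk>x \<in> V; y \<in> V; z \<in> V\<rbrakk> \<Longrightarrow> d x z \<le> d x y + d y z"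
    and dist_neighbour: "\<lbrakk>x \<in> V; y \<in> V; z \<in> V; d y z = 1\<rbrakk> \<Longrightarrow> d x z = d x y + 1 \<or> d x y = d x z + 1"
    and predecessor_ex: "\<lbrakk>x \<in> V; y \<in> V; x \<noteq> y\<rbrakk> \<Longrightarrow> \<exists>z\<in>V. d y z = 1 \<and> d x z + 1 = d x y"
    and predecessor_unique: "\<lbrakk>x \<in> V; y \<in> V; z \<in> V; z' \<in> V; d y z = 1; d y z' = 1;
          d x z + 1 = d x y; d x z' + 1 = d x y\<rbrakk> \<Longrightarrow> z = z'"
begin

section \<open>Geodesics, gates and bridges\<close>

definition between :: "'v \<Rightarrow> 'v \<Rightarrow> 'v \<Rightarrow> bool" where
  "between x y z \<longleftrightarrow> d x z = d x y + d y z"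

definition convex_in :: "'v set \<Rightarrow> bool" where
  "convex_in S \<longleftrightarrow> S \<subseteq> V \<and> (\<forall>x\<in>S. \<forall>y\<in>S. \<forall>z\<in>V. between x z y \<longrightarrow> z \<in> S)"

lemma dist_self [simp]: "x \<in> V \<Longrightarrow> d x x = 0"
  by (simp add: dist_eq_0)

lemma between_sym:
  assumes "x \<in> V" "y \<in> V" "z \<in> V" "between x y z"
  shows "between z y x"
  using assms by (simp add: between_def dist_sym[of z] dist_sym[of y x])

text \<open>The predecessor of \<open>z\<close> as seen from \<open>y\<close> is also its
  predecessor as seen from \<open>x\<close>. Predecessors being unique, a neighbour of
  \<open>z\<close> farther from \<open>y\<close> is also farther from \<open>x\<close>.\<close>

lemma step_away:
  assumes V: "x \<in> V" "y \<in> V" "z \<in> V" "w \<in> V"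
    and b: "between x y z" and "y \<noteq> z" and "d z w = 1" and yw: "d y w = d y z + 1"
  shows "d x w = d x z + 1"
proof (rule ccontr)
  assume "d x w \<noteq> d x z + 1"
  then have w: "d x w + 1 = d x z"
    using dist_neighbour[of x z w] V \<open>d z w = 1\<close> by auto
  obtain u where u: "u \<in> V" "d z u = 1" "d y u + 1 = d y z"
    using predecessor_ex[of y z] V \<open>y \<noteq> z\<close> by auto
  have "d x u \<le> d x y + d y u"
    using dist_triangle V u by simp
  then have "d x u + 1 = d x z"
    using dist_neighbour[of x z u] V u b by (auto simp: between_def)
  then have "u = w"
    using predecessor_unique[of x z u w] V u w \<open>d z w = 1\<close> by simp
  then show False
    using u yw by simp
qed

text \<open>Local geodesics are global: an overlap in a nondegenerate segment rules out
  backtracking. The second geodesic is followed edge by edge; each edge leads away from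
  \<open>y\<close> and hence, by \<open>step_away\<close>, from \<open>x\<close>.\<close>

lemma between_concat:
  assumes "x \<in> V" "y \<in> V" "z \<in> V" "w \<in> V" "between x y z" "between y z w" "y \<noteq> z"
  shows "between x z w"
  using assms
proof (induction "d z w" arbitrary: w)
  case 0
  then show ?case
    using dist_eq_0[of z w] by (auto simp: between_def)
next
  case (Suc n)
  then have "z \<noteq> w" by auto
  then obtain w' where w': "w' \<in> V" "d w w' = 1" "d z w' + 1 = d z w"
    using predecessor_ex[of z w] Suc by auto
  have "d y w' \<le> d y z + d z w'"
    using dist_triangle Suc w' by simp
  then have yw': "d y w' + 1 = d y w" "between y z w'"
    using dist_neighbour[of y w w'] Suc w' by (auto simp: between_def)
  have IH: "between x z w'"
    using Suc.hyps(1)[of w'] Suc.hyps(2) Suc.prems w' yw' by simp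
  have xyw: "between x y w'"
    using IH yw' Suc.prems by (simp add: between_def)
  have "y \<noteq> w'"
  proof
    assume "y = w'"
    then have "d y z = 0" using yw' Suc.prems by (simp add: between_def)
    then show False using Suc.prems dist_eq_0 by auto
  qed
  have "d x w = d x w' + 1"
    by (rule step_away[of x y w' w]) (use Suc.prems w' yw' xyw \<open>y \<noteq> w'\<close> dist_sym in auto)
  then show ?case
    using IH w' by (simp add: between_def)
qed

text \<open>Both \<open>p\<close> and \<open>p'\<close> stay on the geodesic while \<open>z\<close>
  retreats to its predecessor as seen from \<open>v\<close>, until it reaches
  \<open>p'\<close>.\<close>

lemma between_linear:
  assumes "v \<in> V" "z \<in> V" "p \<in> V" "p' \<in> V" "between v p z" "between v p' z" "d v p \<le> d v p'"
  shows "between v p p'"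
  using assms
proof (induction "d p' z" arbitrary: z)
  case 0
  then show ?case using dist_eq_0[of p' z] by auto
next
  case (Suc n)
  then have "p' \<noteq> z" by auto
  then obtain u where u: "u \<in> V" "d z u = 1" "d p' u + 1 = d p' z"
    using predecessor_ex[of p' z] Suc by auto
  have lt: "d v p' < d v z"
    using Suc.prems Suc.hyps(2) by (simp add: between_def)
  have "d v u \<le> d v p' + d p' u"
    using dist_triangle Suc u by simp
  then have vu: "d v u + 1 = d v z"
    using dist_neighbour[of v z u] Suc u by (auto simp: between_def)
  have "p \<noteq> z" using lt Suc.prems by auto
  then obtain u' where u': "u' \<in> V" "d z u' = 1" "d p u' + 1 = d p z"
    using predecessor_ex[of p z] Suc by auto
  have "d v u' \<le> d v p + d p u'"
    using dist_triangle Suc u' by simp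
  then have "d v u' + 1 = d v z"
    using dist_neighbour[of v z u'] Suc u' by (auto simp: between_def)
  then have "u' = u"
    using predecessor_unique[of v z u u'] Suc u u' vu by simp
  show ?case
    by (rule Suc.hyps(1)[of u])
       (use Suc u u' \<open>u' = u\<close> vu in \<open>auto simp: between_def\<close>)
qed

lemma between_unique:
  assumes "v \<in> V" "z \<in> V" "p \<in> V" "p' \<in> V" "between v p z" "between v p' z" "d v p = d v p'"
  shows "p = p'"
  using between_linear[of v z p p'] assms dist_eq_0[of p p'] by (simp add: between_def)

lemma between_linear':
  assumes V: "v \<in> V" "z \<in> V" "p \<in> V" "p' \<in> V"
    and b: "between v p z" "between v p' z" and le: "d v p \<le> d v p'"
  shows "between p p' z"
  using between_linear[OF V b le] b by (simp add: between_def)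

lemma finite_interval:
  assumes "x \<in> V" "y \<in> V"
  shows "finite {z \<in> V. between x z y}"
proof (rule inj_on_finite[where f = "d x" and B = "{..d x y}"])
  show "inj_on (d x) {z \<in> V. between x z y}"
    using between_unique[OF assms] by (auto simp: inj_on_def)
qed (auto simp: between_def)

text \<open>A nearest vertex of \<open>S\<close> works: its neighbour \<open>u\<close> towards
  \<open>q\<close> is outside \<open>S\<close>, so by convexity \<open>u\<close> is not on the way
  to any \<open>s\<close>, and the path from \<open>q\<close> does not turn back.\<close>

lemma gate_ex:
  assumes S: "convex_in S" "S \<noteq> {}" and q: "q \<in> V"
  shows "\<exists>\<pi>\<in>S. \<forall>s\<in>S. between q \<pi> s"
proof -
  obtain \<pi> where \<pi>: "\<pi> \<in> S" "\<And>s. s \<in> S \<Longrightarrow> d q \<pi> \<le> d q s"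
    using S(2) ex_has_least_nat[of "\<lambda>s. s \<in> S" _ "d q"] by blast
  have SV: "s \<in> V" if "s \<in> S" for s using S(1) that unfolding convex_in_def by blast
  have "between q \<pi> s" if s: "s \<in> S" for s
  proof (cases "q = \<pi>")
    case True
    then show ?thesis using q by (simp add: between_def)
  next
    case False
    then obtain u where u: "u \<in> V" "d \<pi> u = 1" "d q u + 1 = d q \<pi>"
      using predecessor_ex[of q \<pi>] q \<pi> SV by auto
    have "u \<notin> S" using \<pi>(2)[of u] u by auto
    have "d u s = d \<pi> s + 1"
    proof (rule ccontr)
      assume "d u s \<noteq> d \<pi> s + 1"
      then have "d s \<pi> = d s u + 1"
        using dist_neighbour[of s \<pi> u] u \<pi> s SV dist_sym by metis
      then have "between \<pi> u s"
        using u \<pi> s SV dist_sym[of s \<pi>] dist_sym[of s u] by (simp add: between_def)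
      then show False using S(1) \<pi>(1) s u(1) \<open>u \<notin> S\<close> unfolding convex_in_def by blast
    qed
    then have "between u \<pi> s" "between q u \<pi>" "u \<noteq> \<pi>"
      using u dist_sym[of u \<pi>] SV \<pi> by (auto simp: between_def)
    then show ?thesis using between_concat[of q u \<pi> s] q u SV \<pi> s by blast
  qed
  then show ?thesis using \<pi> by blast
qed

text \<open>Project an arbitrary \<open>z\<close> of \<open>S'\<close> to \<open>q\<close> in
  \<open>S\<close>, then \<open>q\<close> to \<open>p\<close> in \<open>S'\<close>. The geodesic
  from \<open>z\<close> to \<open>x\<close> passes \<open>p\<close> and then \<open>q\<close>; as
  \<open>q\<close> and \<open>p\<close> differ, geodesics through this bridge concatenate.\<close>

lemma bridge_ex:
  assumes S: "convex_in S" "S \<noteq> {}" and S': "convex_in S'" "S' \<noteq> {}" and dis: "S \<inter> S' = {}"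
  shows "\<exists>q\<in>S. \<exists>p\<in>S'. \<forall>x\<in>S. \<forall>x'\<in>S'. d x x' = d x q + d q p + d p x'"
proof -
  have SV: "s \<in> V" if "s \<in> S \<or> s \<in> S'" for s
    using S(1) S'(1) that unfolding convex_in_def by blast
  obtain z where z: "z \<in> S'" using S' by auto
  obtain q where q: "q \<in> S" "\<And>s. s \<in> S \<Longrightarrow> between z q s"
    using gate_ex[OF S] SV z by metis
  obtain p where p: "p \<in> S'" "\<And>s. s \<in> S' \<Longrightarrow> between q p s"
    using gate_ex[OF S'] SV q by metis
  have "q \<noteq> p" using q p dis by auto
  have "d x x' = d x q + d q p + d p x'" if x: "x \<in> S" and x': "x' \<in> S'" for x x'
  proof -
    have V: "x \<in> V" "x' \<in> V" "q \<in> V" "p \<in> V" "z \<in> V"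
      using SV x x' q(1) p(1) z by blast+
    have "d z x \<le> d z p + d p x" "d p x \<le> d p q + d q x"
      using dist_triangle V by auto
    then have "d p x = d p q + d q x"
      using q(2)[OF x] p(2)[OF z] dist_sym[OF V(3,4)] dist_sym[OF V(5,4)] dist_sym[OF V(5,3)]
      by (simp add: between_def)
    then have xqp: "between x q p"
      using dist_sym[OF V(1,3)] dist_sym[OF V(1,4)] dist_sym[OF V(3,4)] by (simp add: between_def)
    then have "between x p x'"
      using between_concat[OF V(1,3,4,2)] \<open>q \<noteq> p\<close> p(2)[OF x'] by blast
    then show ?thesis using xqp by (simp add: between_def)
  qed
  then show ?thesis using q p by blast
qed

text \<open>The edge by which the geodesic from \<open>q\<close> reaches \<open>m\<close> can point
  towards at most one of \<open>x\<close> and \<open>y\<close>.\<close>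

lemma between_inner:
  assumes V: "x \<in> V" "y \<in> V" "m \<in> V" "q \<in> V" and m: "between x m y"
  shows "between q m x \<or> between q m y"
proof (cases "q = m")
  case True
  then show ?thesis using V by (simp add: between_def)
next
  case False
  then obtain u where u: "u \<in> V" "d m u = 1" "d q u + 1 = d q m"
    using predecessor_ex[of q m] V by auto
  have *: "between q m z" if "z \<in> V" "d z u = d z m + 1" for z
    by (rule between_concat[of q u m z])
       (use that u V dist_sym[of u m] dist_sym[of z u] dist_sym[of z m] in \<open>auto simp: between_def\<close>)
  have "d x y \<le> d x u + d u y" using dist_triangle V u by blast
  then have "d x u = d x m + 1 \<or> d y u = d y m + 1"
    using dist_neighbour[of x m u] dist_neighbour[of y m u] u V m dist_sym[of y u] dist_sym[of y m]
    by (auto simp: between_def)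
  then show ?thesis using * V by blast
qed

end

section \<open>Isometric actions and fixed sets\<close>

locale tree_action = tree_metric V d
  for V :: "'v set" and d :: "'v \<Rightarrow> 'v \<Rightarrow> nat" +
  fixes act :: "'g::group_add \<Rightarrow> 'v \<Rightarrow> 'v"
  assumes act_in [simp]: "v \<in> V \<Longrightarrow> act g v \<in> V"
    and act_zero [simp]: "v \<in> V \<Longrightarrow> act 0 v = v"
    and act_plus: "v \<in> V \<Longrightarrow> act (g + h) v = act g (act h v)"
    and act_dist [simp]: "\<lbrakk>x \<in> V; y \<in> V\<rbrakk> \<Longrightarrow> d (act g x) (act g y) = d x y"
begin

definition Fix :: "'g \<Rightarrow> 'v set" where
  "Fix g = {x \<in> V. act g x = x}"

lemma act_uminus [simp]:
  assumes "x \<in> V"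
  shows "act (- g) (act g x) = x" "act g (act (- g) x) = x"
  using assms act_plus[of x "- g" g] act_plus[of x g "- g"] by auto

lemma Fix_uminus [simp]: "Fix (- g) = Fix g"
  unfolding Fix_def using act_uminus by (metis (no_types, lifting))

lemma dist_act_left:
  assumes "x \<in> V" "y \<in> V"
  shows "d (act g x) y = d x (act (- g) y)"
  by (metis act_dist act_in act_uminus(2) assms)

lemma between_act [simp]:
  "\<lbrakk>x \<in> V; y \<in> V; z \<in> V\<rbrakk> \<Longrightarrow> between (act g x) (act g y) (act g z) \<longleftrightarrow> between x y z"
  by (simp add: between_def)

lemma convex_act:
  assumes "convex_in S"
  shows "convex_in (act g ` S)"
  unfolding convex_in_def
proof (intro conjI ballI impI)
  have SV: "S \<subseteq> V" using assms by (auto simp: convex_in_def)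
  then show "act g ` S \<subseteq> V" by auto
  fix x y z assume xyz: "x \<in> act g ` S" "y \<in> act g ` S" "z \<in> V" "between x z y"
  then obtain x' y' where x': "x' \<in> S" "x = act g x'" and y': "y' \<in> S" "y = act g y'" by auto
  have "between x' (act (- g) z) y'"
    using between_act[of x' "act (- g) z" y' g] xyz x' y' SV by auto
  then have "act (- g) z \<in> S"
    using assms x' y' xyz(3) act_in[of z "- g"] unfolding convex_in_def by blast
  then show "z \<in> act g ` S"
    using xyz(3) by (metis act_uminus(2) imageI)
qed

lemma convex_Fix: "convex_in (Fix g)"
  unfolding convex_in_def
proof (intro conjI ballI impI)
  fix x y z assume xyz: "x \<in> Fix g" "y \<in> Fix g" "z \<in> V" "between x z y"
  have "between x (act g z) y" "d x (act g z) = d x z"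
    using between_act[of x z y g] act_dist[of x z g] xyz by (simp_all add: Fix_def del: between_act act_dist)
  then have "act g z = z"
    using between_unique[of x y "act g z" z] xyz by (auto simp: Fix_def)
  then show "z \<in> Fix g" using xyz by (simp add: Fix_def)
qed (auto simp: Fix_def)

text \<open>The geodesic from \<open>z\<close> reaches \<open>\<pi>\<close> by an edge that
  \<open>g\<close> moves, so its image leaves \<open>\<pi>\<close> by a different edge and the two
  concatenate.\<close>

lemma between_gate_Fix:
  assumes z: "z \<in> V" and \<pi>: "\<pi> \<in> Fix g" and gate: "\<And>s. s \<in> Fix g \<Longrightarrow> between z \<pi> s"
  shows "between z \<pi> (act g z)"
proof (cases "z = \<pi>")
  case True
  then show ?thesis using z by (simp add: between_def)
next
  case False
  have \<pi>V: "\<pi> \<in> V" and \<pi>g: "act g \<pi> = \<pi>" using \<pi> by (auto simp: Fix_def)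
  obtain u where u: "u \<in> V" "d \<pi> u = 1" "d z u + 1 = d z \<pi>"
    using predecessor_ex[of z \<pi>] z \<pi>V False by auto
  have nF: "u \<notin> Fix g" using gate[of u] u by (auto simp: between_def)
  define u' where "u' = act g u"
  have u': "u' \<in> V" "d \<pi> u' = 1" "u' \<noteq> u"
    using u nF act_dist[of \<pi> u g] \<pi>V \<pi>g by (auto simp: u'_def Fix_def simp del: act_dist)
  have "d u u' = 2"
    using dist_neighbour[of u \<pi> u'] dist_eq_0[of u u'] u u' \<pi>V dist_sym[of u \<pi>] by auto
  then have b1: "between z \<pi> u'"
    using between_concat[of z u \<pi> u'] u u' z \<pi>V dist_sym[of u \<pi>]
    by (force simp: between_def)
  have "between \<pi> u' (act g z)"
    using between_act[of \<pi> u z g] between_sym[of z u \<pi>] u z \<pi>V \<pi>g dist_sym[of u \<pi>]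
    by (simp add: u'_def between_def[of z] del: between_act)
  then have "between z u' (act g z)"
    using between_concat[of z \<pi> u' "act g z"] b1 z \<pi>V u' by force
  then show ?thesis
    using \<open>between \<pi> u' (act g z)\<close> b1 by (simp add: between_def)
qed

text \<open>This is Serre's criterion. If \<open>g + h\<close> fixes \<open>z\<close>, then
  \<open>h\<close> and \<open>- g\<close> send \<open>z\<close> to the same vertex, and the gates of
  \<open>z\<close> in both fixed sets are the midpoint of the geodesic to that vertex.\<close>

lemma Fix_intersect:
  assumes "Fix g \<noteq> {}" "Fix h \<noteq> {}" "Fix (g + h) \<noteq> {}"
  shows "Fix g \<inter> Fix h \<noteq> {}"
proof -
  obtain z where z: "z \<in> V" "act (g + h) z = z" using assms(3) by (auto simp: Fix_def)
  then have w: "act h z = act (- g) z"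
    by (metis act_in act_plus act_uminus(1))
  obtain \<pi> where \<pi>: "\<pi> \<in> Fix (- g)" "\<And>s. s \<in> Fix (- g) \<Longrightarrow> between z \<pi> s"
    using gate_ex[OF convex_Fix _ z(1), of "- g"] assms by auto
  obtain \<pi>' where \<pi>': "\<pi>' \<in> Fix h" "\<And>s. s \<in> Fix h \<Longrightarrow> between z \<pi>' s"
    using gate_ex[OF convex_Fix _ z(1), of h] assms by auto
  have "between z \<pi> (act h z)"
    using between_gate_Fix[OF z(1) \<pi>] w by simp
  moreover have "between z \<pi>' (act h z)"
    by (rule between_gate_Fix[OF z(1) \<pi>'])
  moreover have "d \<pi> (act h z) = d \<pi> z" "d \<pi>' (act h z) = d \<pi>' z"
    using act_dist[of \<pi> z "- g"] act_dist[of \<pi>' z h] \<pi>(1) \<pi>'(1) z w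
    unfolding Fix_def by (simp_all del: act_dist)
  ultimately have "\<pi> = \<pi>'"
    using between_unique[of z "act h z" \<pi> \<pi>'] z \<pi>(1) \<pi>'(1) dist_sym[of z \<pi>] dist_sym[of z \<pi>']
    by (auto simp: Fix_def between_def)
  then show ?thesis using \<pi> \<pi>' by auto
qed

text \<open>
  The vertex of \<open>Fix g\<close> nearest to \<open>v\<close> is fixed by every element whose fixed set is at most as far
  from \<open>v\<close> as \<open>Fix g\<close>, because the fixed sets meet pairwise.
\<close>

lemma countably_many_stabilisers_cover:
  assumes ell: "\<And>g. Fix g \<noteq> {}" and v: "v \<in> V"
  shows "\<exists>p::nat \<Rightarrow> 'v. range p \<subseteq> V \<and> (\<forall>g. \<exists>n. act g (p n) = p n)"
proof -
  have "\<exists>\<pi>. \<pi> \<in> Fix g \<and> (\<forall>s\<in>Fix g. between v \<pi> s)" for g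
    using gate_ex[OF convex_Fix ell v] by blast
  then obtain \<pi> where \<pi>: "\<And>g. \<pi> g \<in> Fix g" "\<And>g s. s \<in> Fix g \<Longrightarrow> between v (\<pi> g) s"
    by metis
  have key: "\<pi> g \<in> Fix h" if le: "d v (\<pi> h) \<le> d v (\<pi> g)" for g h
  proof -
    obtain z where z: "z \<in> Fix g" "z \<in> Fix h" using Fix_intersect[OF ell ell ell, of g h] by auto
    have "between (\<pi> h) (\<pi> g) z"
      using between_linear'[of v z "\<pi> h" "\<pi> g"] v \<pi> z le by (auto simp: Fix_def)
    then show ?thesis
      using convex_Fix[of h] \<pi>(1)[of h] \<pi>(1)[of g] z(2) unfolding convex_in_def Fix_def by blast
  qed
  \<comment> \<open>One gate is kept for each distance from \<open>v\<close>; by \<open>key\<close>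
    it serves all elements whose gate is at that distance. The default \<open>v\<close> fills the
    distances that do not occur.\<close>
  define p where "p n = (if \<exists>g. d v (\<pi> g) = n then \<pi> (SOME g. d v (\<pi> g) = n) else v)" for n
  have "act h (p (d v (\<pi> h))) = p (d v (\<pi> h))" for h
  proof -
    have "d v (\<pi> (SOME g. d v (\<pi> g) = d v (\<pi> h))) = d v (\<pi> h)" by (rule someI) simp
    then show ?thesis using key[of h "SOME g. d v (\<pi> g) = d v (\<pi> h)"] by (auto simp: p_def Fix_def)
  qed
  moreover have "range p \<subseteq> V" using v \<pi>(1) by (auto simp: p_def Fix_def)
  ultimately show ?thesis by blast
qed

section \<open>Countable invariant subtrees and growth of products of commutators\<close>

lemma countable_invariant_convex:
  assumes v: "v \<in> V" and \<Gamma>: "countable \<Gamma>"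
  shows "\<exists>S. convex_in S \<and> countable S \<and> v \<in> S \<and> (\<forall>g\<in>\<Gamma>. act g ` S \<subseteq> S)"
proof -
  define segments where "segments S = (\<Union>x\<in>S. \<Union>y\<in>S. {z \<in> V. between x z y})" for S
  \<comment> \<open>Each stage adds all geodesics and then one round of translates. Intervals are
    finite, so countability persists; the element 0 makes the stages increase.\<close>
  define T where "T = rec_nat {v} (\<lambda>_ S. \<Union>g\<in>insert 0 \<Gamma>. act g ` segments S)"
  have T0: "T 0 = {v}" and TS: "T (Suc n) = (\<Union>g\<in>insert 0 \<Gamma>. act g ` segments (T n))" for n
    by (auto simp: T_def)
  have segments_V: "segments A \<subseteq> V" for A
    by (auto simp: segments_def)
  have TV: "T n \<subseteq> V" for n
  proof (induction n)
    case (Suc n)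
    show ?case unfolding TS using segments_V by (auto intro!: act_in)
  qed (simp add: T0 v)
  have segments_T: "segments (T n) \<subseteq> T (Suc n)" "T n \<subseteq> segments (T n)" for n
  proof -
    show "segments (T n) \<subseteq> T (Suc n)"
    proof
      fix z assume "z \<in> segments (T n)"
      then show "z \<in> T (Suc n)"
        unfolding TS by (intro UN_I[of 0]) (auto simp: segments_def intro!: image_eqI[of _ _ z])
    qed
    show "T n \<subseteq> segments (T n)"
    proof
      fix x assume x: "x \<in> T n"
      then have "x \<in> V" using TV by blast
      then show "x \<in> segments (T n)"
        unfolding segments_def using x by (intro UN_I[OF x]) (simp add: between_def)
    qed
  qed
  have mono: "m \<le> n \<Longrightarrow> T m \<subseteq> T n" for m n
    by (rule lift_Suc_mono_le[of T]) (use segments_T in blast)+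
  have "countable (T n)" for n
  proof (induction n)
    case (Suc n)
    have "countable (segments (T n))"
      unfolding segments_def
      by (intro countable_UN[OF Suc] countable_finite finite_interval) (use TV in blast)+
    then show ?case unfolding TS using \<Gamma> by auto
  qed (simp add: T0)
  then have "countable (\<Union>n. T n)" by simp
  moreover have "convex_in (\<Union>n. T n)"
    unfolding convex_in_def
  proof (intro conjI ballI impI)
    fix x y z assume "x \<in> (\<Union>n. T n)" "y \<in> (\<Union>n. T n)" and z: "z \<in> V" "between x z y"
    then obtain m n where "x \<in> T m" "y \<in> T n" by auto
    then have "x \<in> T (max m n)" "y \<in> T (max m n)"
      using mono[of m "max m n"] mono[of n "max m n"] by auto
    then have "z \<in> segments (T (max m n))" using z by (auto simp: segments_def)
    then show "z \<in> (\<Union>n. T n)" using segments_T by blast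
  qed (use TV in blast)
  moreover have "act g ` (\<Union>n. T n) \<subseteq> (\<Union>n. T n)" if "g \<in> \<Gamma>" for g
  proof -
    have "act g ` T n \<subseteq> T (Suc n)" for n
      unfolding TS using that segments_T(2)[of n] by blast
    then show ?thesis by blast
  qed
  moreover have "v \<in> (\<Union>n. T n)" using T0 by blast
  ultimately show ?thesis by blast
qed

text \<open>
  The path to \<open>act (psum t n) (r n)\<close> runs alternately through translates of \<open>S\<close> and \<open>S'\<close>, crossing a
  translate of the bridge \<open>[q, p]\<close> in between, and never backtracks.
\<close>

lemma alternating_path_length:
  fixes t :: "nat \<Rightarrow> 'g"
  defines "c \<equiv> psum t"
  assumes SV: "S \<subseteq> V" "S' \<subseteq> V" and q: "q \<in> S" and p: "p \<in> S'" and "q \<noteq> p"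
    and bridge: "\<And>x x'. \<lbrakk>x \<in> S; x' \<in> S'\<rbrakk> \<Longrightarrow> d x x' = d x q + d q p + d p x'"
    and r: "\<And>i. r i = (if even i then q else p)"
    and even: "\<And>i. even i \<Longrightarrow> act (t i) ` S \<subseteq> S \<and> act (- t i) ` S \<subseteq> S"
    and odd: "\<And>i. odd i \<Longrightarrow> act (t i) ` S' \<subseteq> S' \<and> act (- t i) ` S' \<subseteq> S'"
    and moves: "\<And>i. act (t i) (r i) \<noteq> r i"
  shows "d q (act (c n) (r n)) = (\<Sum>i<n. d (r i) (act (t i) (r i)) + d q p)"
proof -
  have qpV: "q \<in> V" "p \<in> V" using q p SV by auto
  have rV [simp]: "r i \<in> V" for i using qpV by (simp add: r)
  have tV [simp]: "act (t i) (r j) \<in> V" "act (- t i) (r j) \<in> V" for i j by auto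
  have t_side: "act (t i) (r i) \<in> (if even i then S else S')"
               "act (- t i) (r i) \<in> (if even i then S else S')" for i
    using even[of i] odd[of i] q p by (simp_all add: r image_subset_iff)
  have leg: "d (r i) (r (Suc i)) = d q p" for i
    using dist_sym qpV by (simp add: r)
  \<comment> \<open>No backtracking on leaving a bridge: the displacement at its far end stays in
    the side just entered.\<close>
  have leave: "d (r i) (act (t (Suc i)) (r (Suc i))) = d q p + d (r (Suc i)) (act (t (Suc i)) (r (Suc i)))" for i
  proof (cases "even i")
    case True
    then show ?thesis
      using bridge[of q "act (t (Suc i)) (r (Suc i))"] t_side[of "Suc i"] q qpV by (simp add: r)
  next
    case False
    then have "act (t (Suc i)) q \<in> S" using t_side[of "Suc i"] by (simp add: r)
    then have "d (act (t (Suc i)) q) p = d (act (t (Suc i)) q) q + d q p"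
      using bridge[of "act (t (Suc i)) q" p] p qpV by simp
    then show ?thesis
      using False dist_sym[of p "act (t (Suc i)) q"] dist_sym[of q "act (t (Suc i)) q"] qpV by (simp add: r)
  qed
  \<comment> \<open>No backtracking on entering the next bridge: after applying \<open>- t i\<close>
    that bridge starts at \<open>r i\<close>, and the preceding leg stays in one side.\<close>
  have enter: "d (r i) (act (t i) (r (Suc i))) = d (r i) (act (t i) (r i)) + d q p" for i
  proof -
    have "d (r i) (act (t i) (r (Suc i))) = d (act (- t i) (r i)) (r (Suc i))"
      using dist_act_left[of "r i" "r (Suc i)" "- t i"] by simp
    also have "\<dots> = d (act (- t i) (r i)) (r i) + d q p"
    proof (cases "even i")
      case True
      then show ?thesis
        using bridge[of "act (- t i) (r i)" p] t_side[of i] p qpV by (simp add: r)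
    next
      case False
      then have *: "act (- t i) p \<in> S'" using t_side[of i] by (simp add: r)
      then have "d q (act (- t i) p) = d q p + d p (act (- t i) p)"
        using bridge[of q "act (- t i) p"] q qpV by simp
      then show ?thesis
        using False dist_sym[of q "act (- t i) p"] dist_sym[of p "act (- t i) p"] qpV by (simp add: r)
    qed
    also have "d (act (- t i) (r i)) (r i) = d (r i) (act (t i) (r i))"
      using dist_act_left[of "r i" "r i" "- t i"] by simp
    finally show ?thesis .
  qed
  \<comment> \<open>The second conjunct strengthens the induction: the last bridge lies on the
    geodesic from \<open>q\<close>, and being nondegenerate it lets \<open>between_concat\<close>
    attach the next leg.\<close>
  have "d q (act (c n) (r n)) = (\<Sum>i<n. d (r i) (act (t i) (r i)) + d q p) \<and>
      (\<forall>m. n = Suc m \<longrightarrow> between q (act (c n) (r m)) (act (c n) (r n)))"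
  proof (induction n)
    case 0
    then show ?case using qpV by (simp add: c_def r)
  next
    case (Suc n)
    define z where "z = act (c n) (r n)"
    define w1 where "w1 = act (c (Suc n)) (r n)"
    define w2 where "w2 = act (c (Suc n)) (r (Suc n))"
    have V: "z \<in> V" "w1 \<in> V" "w2 \<in> V" by (simp_all add: z_def w1_def w2_def)
    have w_eq: "w1 = act (c n) (act (t n) (r n))" "w2 = act (c n) (act (t n) (r (Suc n)))"
      by (simp_all add: w1_def w2_def c_def act_plus)
    have zw1: "d z w1 = d (r n) (act (t n) (r n))" and zw2: "d z w2 = d (r n) (act (t n) (r (Suc n)))"
      and w12: "d w1 w2 = d q p"
      using leg by (simp_all add: z_def w_eq)
    have b1: "between q z w1"
    proof (cases n)
      case 0
      then show ?thesis using qpV V by (simp add: z_def c_def r between_def)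
    next
      case (Suc m)
      define y where "y = act (c n) (r m)"
      have "y \<in> V" by (simp add: y_def)
      have yz: "d y z = d q p" using leg[of m] Suc by (simp add: y_def z_def)
      then have "y \<noteq> z" using \<open>q \<noteq> p\<close> dist_eq_0[of q p] qpV V by auto
      have "d y w1 = d (r m) (act (t n) (r n))" by (simp add: y_def w_eq)
      then have "between y z w1" using leave[of m] Suc yz zw1 by (simp add: between_def)
      moreover have "between q y z" using Suc.IH Suc by (simp add: y_def z_def)
      ultimately show ?thesis
        using between_concat[of q y z w1] qpV V \<open>y \<in> V\<close> \<open>y \<noteq> z\<close> by blast
    qed
    have "d (r n) (act (t n) (r n)) \<noteq> 0"
      using moves[of n] dist_eq_0[of "r n" "act (t n) (r n)"] by auto
    then have "z \<noteq> w1" using zw1 V by auto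
    moreover have "between z w1 w2" using enter zw1 zw2 w12 by (simp add: between_def)
    ultimately have b2: "between q w1 w2"
      using between_concat[of q z w1 w2] b1 qpV V by blast
    have "d q z = (\<Sum>i<n. d (r i) (act (t i) (r i)) + d q p)"
      using Suc.IH by (simp add: z_def)
    then have "d q w2 = (\<Sum>i<Suc n. d (r i) (act (t i) (r i)) + d q p)"
      using b1 b2 zw1 w12 unfolding between_def by simp
    then show ?case
      using b2 unfolding w1_def w2_def by blast
  qed
  then show ?thesis by blast
qed

text \<open>Let \<open>q\<close> be the end in \<open>S\<close> of the bridge to the translate of
  \<open>S\<close>. The alternating path shows that the \<open>k\<close>-th power moves
  \<open>q\<close> by exactly \<open>k * T\<close>; replacing \<open>q\<close> by \<open>v\<close>
  costs at most \<open>2 * d q v\<close>, which \<open>displ\<close> bounds by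
  \<open>T\<close>.\<close>

lemma commutator_product_length:
  assumes S: "convex_in S" "v \<in> S" and dis: "act y ` S \<inter> S = {}"
    and a: "act a ` S \<subseteq> S" "act (- a) ` S \<subseteq> S" and b: "act b ` S \<subseteq> S" "act (- b) ` S \<subseteq> S"
    and free: "Fix a = {}" "Fix b = {}"
    and displ: "\<And>q. q \<in> V \<Longrightarrow> 2 * d q v \<le> d q (act a q) + d q (act b q)"
  shows "\<exists>T\<ge>1. d v (act y v) \<le> T \<and>
    (\<forall>k. k * T \<le> d v (act (psum (\<lambda>_. commutator_product a b y) k) v) + T)"
proof -
  have SV: "S \<subseteq> V" using S by (simp add: convex_in_def)
  have S': "convex_in (act y ` S)" by (rule convex_act[OF S(1)])
  then have SV': "act y ` S \<subseteq> V" by (simp add: convex_in_def)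
  obtain q p where q: "q \<in> S" and p: "p \<in> act y ` S"
    and bridge: "\<And>x x'. \<lbrakk>x \<in> S; x' \<in> act y ` S\<rbrakk> \<Longrightarrow> d x x' = d x q + d q p + d p x'"
    using bridge_ex[OF S(1) _ S'] S(2) dis by blast
  obtain q' where q': "q' \<in> S" "p = act y q'" using p by auto
  have V: "q \<in> V" "p \<in> V" "v \<in> V" "q' \<in> V" using q p q' S SV SV' by auto
  have "q \<noteq> p" using q p dis by auto
  define a1 where "a1 = y + - a + - y"
  define b1 where "b1 = y + - b + - y"
  have conj: "act (y + - f + - y) (act y x) = act y (act (- f) x)"
             "act (- (y + - f + - y)) (act y x) = act y (act f x)" if "x \<in> V" for f x
  proof -
    show "act (y + - f + - y) (act y x) = act y (act (- f) x)"
      using that by (simp add: act_plus del: add_uminus_conv_diff)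
    have "- (y + - f + - y) = y + f + - y"
      by (simp add: minus_add add.assoc del: add_uminus_conv_diff)
    then show "act (- (y + - f + - y)) (act y x) = act y (act f x)"
      using that by (simp add: act_plus del: add_uminus_conv_diff)
  qed
  have conj_inv: "act (y + - f + - y) ` act y ` S \<subseteq> act y ` S"
                 "act (- (y + - f + - y)) ` act y ` S \<subseteq> act y ` S"
    if "act f ` S \<subseteq> S" "act (- f) ` S \<subseteq> S" for f
  proof -
    have "act (y + - f + - y) ` act y ` S = act y ` act (- f) ` S"
         "act (- (y + - f + - y)) ` act y ` S = act y ` act f ` S"
      unfolding image_image by (intro image_cong refl conj; use SV in blast)+
    then show "act (y + - f + - y) ` act y ` S \<subseteq> act y ` S"
              "act (- (y + - f + - y)) ` act y ` S \<subseteq> act y ` S"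
      using that by (simp_all only: image_mono)
  qed
  have moves: "act f x \<noteq> x" "act (- f) x \<noteq> x" if "Fix f = {}" "x \<in> V" for f x
    using that Fix_uminus[of f] by (auto simp: Fix_def)
  \<comment> \<open>Period 4 runs through the factors of the commutator product, so
    \<open>4 * k\<close> terms give its \<open>k\<close>-th power.\<close>
  define t where "t i = (if i mod 4 = 0 then a else if i mod 4 = 1 then a1 else if i mod 4 = 2 then b else b1)"
    for i :: nat
  define r where "r i = (if even i then q else p)" for i :: nat
  have ev: "t i = a \<or> t i = b" if "even i" for i
  proof -
    have "i mod 4 = 0 \<or> i mod 4 = 2" using that by presburger
    then show ?thesis by (auto simp: t_def)
  qed
  have od: "t i = a1 \<or> t i = b1" if "odd i" for i
  proof -
    have "i mod 4 = 1 \<or> i mod 4 = 3" using that by presburger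
    then show ?thesis by (auto simp: t_def)
  qed
  have S'_inv: "act a1 ` act y ` S \<subseteq> act y ` S" "act (- a1) ` act y ` S \<subseteq> act y ` S"
               "act b1 ` act y ` S \<subseteq> act y ` S" "act (- b1) ` act y ` S \<subseteq> act y ` S"
    unfolding a1_def b1_def using conj_inv a b by blast+
  have moves_r: "act (t i) (r i) \<noteq> r i" for i
  proof (cases "even i")
    case True
    then show ?thesis using ev[OF True] moves(1) free V by (auto simp: r_def)
  next
    case False
    have "act (y + - f + - y) p \<noteq> p" if "Fix f = {}" for f
    proof
      assume "act (y + - f + - y) p = p"
      then have "act y (act (- f) q') = act y q'"
        using conj(1)[OF V(4), of f] q'(2) by (simp del: add_uminus_conv_diff)
      then have "act (- f) q' = q'" by (metis V(4) act_in act_uminus(1))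
      then show False using moves(2)[OF that V(4)] by simp
    qed
    then show ?thesis using False od[OF False] free by (auto simp: r_def a1_def b1_def)
  qed
  have evS: "act (t i) ` S \<subseteq> S \<and> act (- t i) ` S \<subseteq> S" if "even i" for i
    using ev[OF that] a b by metis
  have odS: "act (t i) ` act y ` S \<subseteq> act y ` S \<and> act (- t i) ` act y ` S \<subseteq> act y ` S" if "odd i" for i
    using od[OF that] S'_inv by metis
  have len: "d q (act (psum t n) (r n)) = (\<Sum>i<n. d (r i) (act (t i) (r i)) + d q p)" for n
    by (rule alternating_path_length[OF SV SV' q p \<open>q \<noteq> p\<close> bridge r_def evS odS moves_r])
  \<comment> \<open>The length of one period: four legs and four bridges. The legs at
    \<open>p\<close> come from conjugates by \<open>y\<close>, so they are measured at
    \<open>q'\<close>.\<close>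
  define T where "T = d q (act a q) + d q (act b q) + (d q' (act a q') + d q' (act b q')) + 4 * d q p"
  have conj_dist: "d p (act (y + - f + - y) p) = d q' (act f q')" for f
  proof -
    have "d p (act (y + - f + - y) p) = d q' (act (- f) q')"
      using conj(1)[OF V(4), of f] q'(2) V by (simp del: add_uminus_conv_diff)
    then show ?thesis using dist_act_left[of q' q' f] dist_sym[of q' "act f q'"] V by simp
  qed
  have four: "psum t (4 * k) = psum (\<lambda>_. commutator_product a b y) k" for k
  proof (induction k)
    case (Suc k)
    have t4: "t (4 * k) = a" "t (Suc (4 * k)) = a1" "t (Suc (Suc (4 * k))) = b" "t (Suc (Suc (Suc (4 * k)))) = b1"
      by (simp_all add: t_def mod_Suc)
    have "4 * Suc k = Suc (Suc (Suc (Suc (4 * k))))" by simp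
    then show ?case
      by (simp only: psum.simps Suc t4 commutator_product_def a1_def b1_def add.assoc)
  qed simp
  have sum4: "(\<Sum>i<4 * k. d (r i) (act (t i) (r i)) + d q p) = k * T" for k
  proof (induction k)
    case (Suc k)
    have t4: "t (4 * k) = a" "t (Suc (4 * k)) = a1" "t (Suc (Suc (4 * k))) = b" "t (Suc (Suc (Suc (4 * k)))) = b1"
      by (simp_all add: t_def mod_Suc)
    have r4: "r (4 * k) = q" "r (Suc (4 * k)) = p" "r (Suc (Suc (4 * k))) = q" "r (Suc (Suc (Suc (4 * k)))) = p"
      by (simp_all add: r_def)
    have "4 * Suc k = Suc (Suc (Suc (Suc (4 * k))))" by simp
    moreover have "d p (act a1 p) = d q' (act a q')" "d p (act b1 p) = d q' (act b q')"
      "d p q = d q p"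
      using conj_dist dist_sym V by (simp_all add: a1_def b1_def del: add_uminus_conv_diff)
    ultimately show ?case
      using Suc by (simp only: sum.lessThan_Suc t4 r4) (simp add: T_def)
  qed simp
  have "k * T \<le> d v (act (psum (\<lambda>_. commutator_product a b y) k) v) + T" for k
  proof -
    define h where "h = psum (\<lambda>_. commutator_product a b y) k"
    have "k * T = d q (act h q)"
      using len[of "4 * k"] sum4 four by (simp add: h_def r_def)
    also have "\<dots> \<le> d q v + d v (act h v) + d (act h v) (act h q)"
      using dist_triangle[of q v "act h q"] dist_triangle[of v "act h v" "act h q"] V by simp
    also have "\<dots> = d v (act h v) + 2 * d q v"
      using dist_sym[of v q] V by simp
    also have "\<dots> \<le> d v (act h v) + T"
      using displ[of q] V by (simp add: T_def)
    finally show ?thesis by (simp add: h_def)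
  qed
  moreover have "d v (act y v) \<le> T"
  proof -
    have "d v (act y v) \<le> d q v + d q p + d q' v"
      using bridge[of v "act y v"] S dist_sym[of v q] V q' by simp
    then show ?thesis using displ[of q] displ[of q'] V by (simp add: T_def)
  qed
  moreover have "1 \<le> T"
    using \<open>q \<noteq> p\<close> dist_eq_0[of q p] V by (simp add: T_def)
  ultimately show ?thesis by blast
qed

text \<open>The exponent depends only on the bound \<open>M\<close> for \<open>g\<close>, whereas
  \<open>T\<close> varies with \<open>y\<close>. As \<open>T\<close> is at least 1, \<open>M\<close>
  periods absorb the loss from \<open>g\<close>; of the other three, one pays for the base vertex
  and two exceed \<open>d v (act y v)\<close>.\<close>

lemma commutator_product_growth:
  assumes "convex_in S" "v \<in> S" "act y ` S \<inter> S = {}"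
    and "act a ` S \<subseteq> S" "act (- a) ` S \<subseteq> S" "act b ` S \<subseteq> S" "act (- b) ` S \<subseteq> S"
    and "Fix a = {}" "Fix b = {}"
    and "\<And>q. q \<in> V \<Longrightarrow> 2 * d q v \<le> d q (act a q) + d q (act b q)"
    and g: "d v (act g v) \<le> M"
  shows "d v (act y v) < d v (act (psum (\<lambda>_. commutator_product a b y) (M + 3) + g) v)"
proof -
  define h where "h = psum (\<lambda>_. commutator_product a b y) (M + 3)"
  obtain T where T: "1 \<le> T" "d v (act y v) \<le> T" "(M + 3) * T \<le> d v (act h v) + T"
    using commutator_product_length[OF assms(1-10)] unfolding h_def by blast
  have v: "v \<in> V" using assms(1,2) by (auto simp: convex_in_def)
  have "d v (act h v) \<le> d v (act (h + g) v) + d (act h (act g v)) (act h v)"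
    using dist_triangle[of v "act (h + g) v" "act h v"] v by (simp add: act_plus)
  also have "d (act h (act g v)) (act h v) \<le> M"
    using g v dist_sym[of v "act g v"] by simp
  finally have "(M + 3) * T \<le> d v (act (h + g) v) + M + T" using T by simp
  moreover have "M * T \<ge> M" using T by simp
  moreover have "(M + 3) * T = M * T + 3 * T" by (simp add: algebra_simps)
  ultimately have "d v (act (h + g) v) \<ge> 2 * T" by linarith
  then show ?thesis using T by (simp add: h_def)
qed

text \<open>The geodesic from \<open>q\<close> to its gate and the image of this geodesic are joined
  inside \<open>S\<close> by a segment that is nondegenerate because \<open>a\<close> fixes no
  vertex.\<close>

lemma displacement_ge:
  assumes S: "convex_in S" "S \<noteq> {}" and a: "act a ` S \<subseteq> S" "act (- a) ` S \<subseteq> S"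
    and free: "Fix a = {}" and q: "q \<in> V" and \<pi>: "\<pi> \<in> S" "\<And>s. s \<in> S \<Longrightarrow> between q \<pi> s"
  shows "2 * d q \<pi> \<le> d q (act a q)"
proof -
  have SV: "S \<subseteq> V" using S(1) by (simp add: convex_in_def)
  have V: "\<pi> \<in> V" "act a \<pi> \<in> V" "act a q \<in> V" using \<pi>(1) SV q by auto
  have "act a \<pi> \<in> S" "act (- a) \<pi> \<in> S" using a \<pi>(1) by blast+
  then have "between q (act (- (- a)) (act (- a) \<pi>)) (act (- a) \<pi>)" "between q \<pi> (act a \<pi>)"
    using \<pi>(2) V by simp_all
  then have "between (act a q) (act a \<pi>) \<pi>"
    using between_act[of q \<pi> "act (- a) \<pi>" a] V q by simp
  then have "between \<pi> (act a \<pi>) (act a q)"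
    using between_sym V by blast
  moreover have "\<pi> \<noteq> act a \<pi>" using free V by (auto simp: Fix_def)
  ultimately have "between q (act a \<pi>) (act a q)"
    using between_concat[of q \<pi> "act a \<pi>" "act a q"] \<open>between q \<pi> (act a \<pi>)\<close> V q by blast
  then show ?thesis
    using \<open>between q \<pi> (act a \<pi>)\<close> dist_sym[of \<pi> q] V q by (simp add: between_def)
qed

text \<open>The vertex \<open>v\<close> is the end in \<open>S\<close> of the bridge to the
  translate of \<open>S\<close>. The geodesic from \<open>q\<close> to its gate in one of the two
  sets meets \<open>v\<close>, so \<open>d q v\<close> is at most the sum of the distances to both
  gates, each at most half a displacement.\<close>

lemma conjugate_pair:
  assumes S: "convex_in S" "S \<noteq> {}" and a: "act a ` S \<subseteq> S" "act (- a) ` S \<subseteq> S"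
    and free: "Fix a = {}" and dis: "act y ` S \<inter> S = {}"
  shows "Fix (y + a + - y) = {} \<and>
    (\<exists>v\<in>V. \<forall>q\<in>V. 2 * d q v \<le> d q (act a q) + d q (act (y + a + - y) q))"
proof -
  define b where "b = y + a + - y"
  define S' where "S' = act y ` S"
  have SV: "S \<subseteq> V" using S(1) by (simp add: convex_in_def)
  have S': "convex_in S'" "S' \<noteq> {}" unfolding S'_def using convex_act S by auto
  then have SV': "S' \<subseteq> V" by (simp add: convex_in_def)
  have mb: "- b = y + - a + - y"
    unfolding b_def by (simp add: minus_add add.assoc del: add_uminus_conv_diff)
  have b_act: "act b (act y x) = act y (act a x)" "act (- b) (act y x) = act y (act (- a) x)"
    if "x \<in> V" for x
    unfolding mb using that by (simp_all add: b_def act_plus del: add_uminus_conv_diff)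
  have "act b ` S' = act y ` act a ` S" "act (- b) ` S' = act y ` act (- a) ` S"
    unfolding S'_def image_image by (intro image_cong refl b_act; use SV in blast)+
  then have b: "act b ` S' \<subseteq> S'" "act (- b) ` S' \<subseteq> S'"
    unfolding S'_def using a by (simp_all only: image_mono)
  have free_b: "Fix b = {}"
  proof (rule ccontr)
    assume "Fix b \<noteq> {}"
    then obtain x where x: "x \<in> V" "act b x = x" by (auto simp: Fix_def)
    then have "act y (act a (act (- y) x)) = act y (act (- y) x)"
      using b_act(1)[of "act (- y) x"] by simp
    then have "act a (act (- y) x) = act (- y) x"
      by (metis act_in act_uminus(1) x(1))
    then show False using free x by (auto simp: Fix_def)
  qed
  obtain v p where v: "v \<in> S" and p: "p \<in> S'"
    and bridge: "\<And>x x'. \<lbrakk>x \<in> S; x' \<in> S'\<rbrakk> \<Longrightarrow> d x x' = d x v + d v p + d p x'"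
    using bridge_ex[OF S S'] dis unfolding S'_def by blast
  have "2 * d q v \<le> d q (act a q) + d q (act b q)" if q: "q \<in> V" for q
  proof -
    obtain \<pi> where \<pi>: "\<pi> \<in> S" "\<And>s. s \<in> S \<Longrightarrow> between q \<pi> s" using gate_ex[OF S q] by blast
    obtain \<pi>' where \<pi>': "\<pi>' \<in> S'" "\<And>s. s \<in> S' \<Longrightarrow> between q \<pi>' s" using gate_ex[OF S' q] by blast
    have V: "v \<in> V" "\<pi> \<in> V" "\<pi>' \<in> V" using v \<pi>(1) \<pi>'(1) SV SV' by auto
    have "d q v \<le> d q \<pi> + d q \<pi>'"
    proof (cases "\<pi> = v")
      case False
      have "between \<pi> v \<pi>'"
        using bridge[OF \<pi>(1) \<pi>'(1)] bridge[OF v \<pi>'(1)] V by (simp add: between_def)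
      then have "between q v \<pi>'"
        using between_concat[of q \<pi> v \<pi>'] \<pi>(2)[OF v] V q False by blast
      then show ?thesis by (simp add: between_def)
    qed simp
    then show ?thesis
      using displacement_ge[OF S a free q \<pi>] displacement_ge[OF S' b free_b q \<pi>'] by simp
  qed
  then show ?thesis using free_b v SV by (auto simp: b_def)
qed

text \<open>
  Among the vertices at least distance from the farthest point of a finite orbit, two distinct
  ones are adjacent.
\<close>

lemma finite_orbit_imp_fixed_vertex:
  assumes O: "finite Q" "Q \<noteq> {}" "Q \<subseteq> V" "\<And>g. act g ` Q \<subseteq> Q"
    and no_inversion: "\<And>g x. x \<in> V \<Longrightarrow> d x (act g x) \<noteq> 1"
  shows "\<exists>x\<in>V. \<forall>g. act g x = x"
proof -
  define r where "r x = Max (d x ` Q)" for x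
  have r_ge: "q \<in> Q \<Longrightarrow> d x q \<le> r x" for x q
    unfolding r_def using O(1) by simp
  have r_le: "(\<And>q. q \<in> Q \<Longrightarrow> d x q \<le> n) \<Longrightarrow> r x \<le> n" for x n
    unfolding r_def using O(1,2) by simp
  have "\<exists>x. x \<in> V" using O by blast
  then obtain x where x: "x \<in> V" "\<And>y. y \<in> V \<Longrightarrow> r x \<le> r y"
    using ex_has_least_nat[of "\<lambda>x. x \<in> V" _ r] by blast
  have "act g x = x" for g
  proof (rule ccontr)
    assume ne: "act g x \<noteq> x"
    have rg: "r (act g x) \<le> r x"
    proof (rule r_le)
      fix q assume q: "q \<in> Q"
      then have "act (- g) q \<in> Q" "q \<in> V" using O by blast+
      then show "d (act g x) q \<le> r x" using r_ge dist_act_left x(1) by simp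
    qed
    obtain z where z: "z \<in> V" "d (act g x) z = 1" "d x z + 1 = d x (act g x)"
      using predecessor_ex[of x "act g x"] ne x(1) by auto
    have xz: "d x z \<ge> 1" using z no_inversion[OF x(1), of g] by simp
    have b: "between x z (act g x)"
      using z dist_sym[of z "act g x"] x(1) by (simp add: between_def)
    \<comment> \<open>As no vertex is moved to a neighbour, \<open>z\<close> lies strictly inside
      the segment, so every orbit point is nearer to \<open>z\<close> than to one of the
      ends.\<close>
    have *: "d z q + 1 \<le> r x" if q: "q \<in> Q" for q
    proof -
      have qV: "q \<in> V" using q O by blast
      have "between q z x \<or> between q z (act g x)"
        using between_inner[of x "act g x" z q] x(1) z(1) qV b by simp
      then have "d z q + d z x \<le> d x q \<or> d z q + 1 \<le> d (act g x) q"
        using dist_sym qV x(1) z act_in by (metis between_def order_refl)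
      then show ?thesis
        using r_ge[OF q, of x] r_ge[OF q, of "act g x"] rg xz dist_sym[of z x] z x(1) by auto
    qed
    have "r z \<le> r x - 1"
      by (rule r_le) (use * in fastforce)
    \<comment> \<open>This excludes truncation in \<open>r x - 1\<close>.\<close>
    moreover have "r x \<ge> 1" using * O(2) by fastforce
    ultimately show False using x(2)[OF z(1)] by simp
  qed
  then show ?thesis using x(1) by blast
qed

end

section \<open>The metric of a simplicial tree\<close>

abbreviation adjacency :: "'v set set \<Rightarrow> ('v \<times> 'v) set" where
  "adjacency E \<equiv> {(x, y). {x, y} \<in> E}"

definition graph_dist :: "'v set set \<Rightarrow> 'v \<Rightarrow> 'v \<Rightarrow> nat" where
  "graph_dist E x y = (LEAST n. (x, y) \<in> {(x, y). {x, y} \<in> E} ^^ n)"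

lemma bipartition_unordered:
  assumes "bipartition V E A B" "{x, y} \<in> E"
  shows "x \<in> A \<longleftrightarrow> y \<notin> A" "x \<in> V" "y \<in> V"
proof -
  obtain a b where ab: "a \<in> A" "b \<in> B" "{x, y} = {a, b}" and AB: "A \<inter> B = {}" "A \<union> B = V"
    using assms unfolding bipartition_def by metis
  then have "x = a \<and> y = b \<or> x = b \<and> y = a" by (simp add: doubleton_eq_iff)
  then show "x \<in> A \<longleftrightarrow> y \<notin> A" "x \<in> V" "y \<in> V" using ab(1,2) AB by blast+
qed

context
  fixes V :: "'v set" and E :: "'v set set" and A B :: "'v set"
  assumes tree: "simplicial_tree V E" and bip: "bipartition V E A B"
begin

lemma graph_dist_walk:
  assumes "x \<in> V" "y \<in> V"
  shows "(x, y) \<in> adjacency E ^^ graph_dist E x y"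
proof -
  have "(x, y) \<in> (adjacency E)\<^sup>*" using tree assms by (simp add: simplicial_tree_def)
  then obtain n where "(x, y) \<in> adjacency E ^^ n" using rtrancl_imp_relpow by blast
  then show ?thesis unfolding graph_dist_def by (rule LeastI)
qed

lemma graph_dist_le: "(x, y) \<in> adjacency E ^^ n \<Longrightarrow> graph_dist E x y \<le> n"
  unfolding graph_dist_def by (rule Least_le)

lemma graph_dist_0:
  assumes "x \<in> V" "y \<in> V"
  shows "graph_dist E x y = 0 \<longleftrightarrow> x = y"
proof
  show "graph_dist E x y = 0 \<Longrightarrow> x = y" using graph_dist_walk[OF assms] by (metis relpow_0_E)
  show "x = y \<Longrightarrow> graph_dist E x y = 0" using graph_dist_le[of x y 0] by simp
qed

lemma walk_sym: "(x, y) \<in> adjacency E ^^ n \<Longrightarrow> (y, x) \<in> adjacency E ^^ n"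
proof (induction n arbitrary: y)
  case (Suc n)
  then obtain z where z: "(x, z) \<in> adjacency E ^^ n" "(z, y) \<in> adjacency E" by auto
  then have "(y, z) \<in> adjacency E" by (simp add: insert_commute)
  then show ?case using Suc.IH[OF z(1)] by (meson relpow_Suc_I2)
qed simp

text \<open>Every edge changes the class. Parity is what keeps adjacent vertices from having the
  same distance to a third one.\<close>

lemma walk_parity: "(x, y) \<in> adjacency E ^^ n \<Longrightarrow> (x \<in> A \<longleftrightarrow> y \<in> A) \<longleftrightarrow> even n"
proof (induction n arbitrary: y)
  case (Suc n)
  then obtain z where z: "(x, z) \<in> adjacency E ^^ n" "(z, y) \<in> adjacency E" by auto
  then show ?case using Suc.IH[OF z(1)] bipartition_unordered(1)[OF bip, of z y] by auto
qed simp

lemma graph_dist_1: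
  assumes "x \<in> V" "y \<in> V"
  shows "graph_dist E x y = 1 \<longleftrightarrow> {x, y} \<in> E"
proof
  assume "graph_dist E x y = 1"
  then show "{x, y} \<in> E" using graph_dist_walk[OF assms] by simp
next
  assume e: "{x, y} \<in> E"
  have "graph_dist E x y \<le> 1" by (rule graph_dist_le) (use e in simp)
  moreover have "graph_dist E x y \<noteq> 0"
  proof
    assume "graph_dist E x y = 0"
    then have "x = y" using graph_dist_walk[OF assms] by simp
    then show False using e tree by (auto simp: simplicial_tree_def)
  qed
  ultimately show "graph_dist E x y = 1" by simp
qed

lemma graph_dist_triangle:
  assumes "x \<in> V" "y \<in> V" "z \<in> V"
  shows "graph_dist E x z \<le> graph_dist E x y + graph_dist E y z"
  by (rule graph_dist_le, unfold relpow_add)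
     (rule relcompI[OF graph_dist_walk[OF assms(1,2)] graph_dist_walk[OF assms(2,3)]])

text \<open>
  Two distinct predecessors of a vertex are joined by descending towards the root until the two
  descents meet, which closes a cycle.
\<close>

lemma graph_predecessor_unique:
  assumes x: "x \<in> V" and y: "y \<in> V" and z: "z \<in> V" "{y, z} \<in> E" "graph_dist E x z + 1 = graph_dist E x y"
    and z': "z' \<in> V" "{y, z'} \<in> E" "graph_dist E x z' + 1 = graph_dist E x y"
  shows "z = z'"
proof (rule ccontr)
  assume ne: "z \<noteq> z'"
  have pred: "\<exists>u\<in>V. {w, u} \<in> E \<and> graph_dist E x u + 1 = graph_dist E x w" if "w \<in> V" "w \<noteq> x" for w
  proof -
    have "(x, w) \<in> adjacency E ^^ graph_dist E x w" using graph_dist_walk x that by simp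
    moreover have "graph_dist E x w \<noteq> 0"
      using graph_dist_0 x that by blast
    ultimately obtain n u where n: "graph_dist E x w = Suc n" "(x, u) \<in> adjacency E ^^ n" "(u, w) \<in> adjacency E"
      by (metis not0_implies_Suc relpow_Suc_E)
    then have "{w, u} \<in> E" by (simp add: insert_commute)
    then have "u \<in> V" using bipartition_unordered[OF bip] by blast
    have "graph_dist E x u \<le> n" using n graph_dist_le by blast
    moreover have "graph_dist E x w \<le> graph_dist E x u + graph_dist E u w" using graph_dist_triangle x that \<open>u \<in> V\<close> by blast
    moreover have "graph_dist E u w = 1" using graph_dist_1 \<open>u \<in> V\<close> that n by blast
    ultimately show ?thesis using \<open>{w, u} \<in> E\<close> \<open>u \<in> V\<close> n by force
  qed
  \<comment> \<open>\<open>par\<close> descends one step towards the root \<open>x\<close>; from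
    either predecessor it reaches \<open>x\<close> after \<open>m\<close> steps.\<close>
  define par where "par w = (SOME u. u \<in> V \<and> {w, u} \<in> E \<and> graph_dist E x u + 1 = graph_dist E x w)" for w
  have par: "par w \<in> V" "{w, par w} \<in> E" "graph_dist E x (par w) + 1 = graph_dist E x w" if "w \<in> V" "w \<noteq> x" for w
    using someI_ex[of "\<lambda>u. u \<in> V \<and> {w, u} \<in> E \<and> graph_dist E x u + 1 = graph_dist E x w"] pred[OF that]
    unfolding par_def by blast+
  define m where "m = graph_dist E x z"
  have dxx: "graph_dist E x x = 0" using graph_dist_0 x by blast
  have desc: "(par ^^ i) w \<in> V \<and> graph_dist E x ((par ^^ i) w) = m - i" if "w \<in> V" "graph_dist E x w = m" "i \<le> m" for i w
    using that(3)
  proof (induction i)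
    case (Suc i)
    then have "(par ^^ i) w \<noteq> x" using dxx by auto
    then show ?case using par[of "(par ^^ i) w"] Suc by auto
  qed (use that in simp)
  have mz': "graph_dist E x z' = m" using z z' m_def by simp
  have dx0: "w = x" if "w \<in> V" "graph_dist E x w = 0" for w
    using graph_dist_0 x that by blast
  have root: "(par ^^ m) w = x" if "w \<in> V" "graph_dist E x w = m" for w
    by (rule dx0) (use desc[OF that order_refl] in simp_all)
  have "(par ^^ m) z = (par ^^ m) z'"
    using root[OF z(1)] root[OF z'(1) mz'] by (simp add: m_def)
  \<comment> \<open>The first meeting of the two descents; its minimality makes the cycle
    simple.\<close>
  then obtain k where k: "(par ^^ k) z = (par ^^ k) z'" "\<And>j. j < k \<Longrightarrow> (par ^^ j) z \<noteq> (par ^^ j) z'" "k \<le> m"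
    using exists_least_iff[of "\<lambda>k. (par ^^ k) z = (par ^^ k) z'"]
    by (metis leI)
  have "k \<noteq> 0" using k(1) ne by (metis funpow_0)
  \<comment> \<open>Index 0 is \<open>y\<close>, indices 1 to \<open>k + 1\<close> descend from
    \<open>z\<close> to the meeting vertex, and the rest ascend to \<open>z'\<close> at the last
    index \<open>2 * k + 1\<close>.\<close>
  define f where "f i = (if i = 0 then y else if i \<le> k + 1 then (par ^^ (i - 1)) z
                         else (par ^^ (2 * k + 1 - i)) z')" for i
  define xs where "xs = map f [0..<2 * k + 2]"
  have len: "length xs = 2 * k + 2" and nth: "i < 2 * k + 2 \<Longrightarrow> xs ! i = f i" for i
    unfolding xs_def by (simp_all del: upt_Suc add_2_eq_Suc')
  have step: "{(par ^^ i) w, (par ^^ Suc i) w} \<in> E" if "w \<in> V" "graph_dist E x w = m" "i < m" for w i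
  proof -
    have "(par ^^ i) w \<in> V" "graph_dist E x ((par ^^ i) w) = m - i" using desc that by auto
    then have "(par ^^ i) w \<noteq> x" using that dxx by auto
    then show ?thesis using par \<open>(par ^^ i) w \<in> V\<close> by simp
  qed
  have lev: "graph_dist E x (f i) = (if i = 0 then m + 1 else if i \<le> k + 1 then m - (i - 1) else m - (2 * k + 1 - i))"
    if "i < 2 * k + 2" for i
    using that desc[of z "i - 1"] desc[of z' "2 * k + 1 - i"] mz' z z' k(3)
    by (auto simp: f_def m_def)
  have "inj_on f {0..<2 * k + 2}"
  proof (rule linorder_inj_onI)
    fix i j :: nat assume ij: "i < j" "i \<in> {0..<2 * k + 2}" "j \<in> {0..<2 * k + 2}"
    show "f i \<noteq> f j"
    proof
      assume eq: "f i = f j"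
      then have l: "graph_dist E x (f i) = graph_dist E x (f j)" by simp
      \<comment> \<open>Equal levels occur only at equal depth on opposite branches, before the
        meeting vertex.\<close>
      then have i0: "i \<noteq> 0" "i \<le> k + 1" "j > k + 1" "i - 1 = 2 * k + 1 - j"
        using lev[of i] lev[of j] ij k(3) by (auto split: if_splits)
      then have "(par ^^ (i - 1)) z = (par ^^ (i - 1)) z'" "i - 1 < k"
        using eq ij by (auto simp: f_def)
      then show False using k(2) by blast
    qed
  qed auto
  then have "distinct xs" unfolding xs_def distinct_map by (simp only: distinct_upt set_upt simp_thms)
  moreover have "{xs ! i, xs ! (Suc i mod length xs)} \<in> E" if "i < length xs" for i
  proof -
    have i: "i < 2 * k + 2" using that len by simp
    \<comment> \<open>The edge from \<open>y\<close> to \<open>z\<close>, the descent, the turn at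
      the meeting vertex, the ascent, and the closing edge from \<open>z'\<close> to
      \<open>y\<close>.\<close>
    consider "i = 0" | "0 < i" "i \<le> k" | "i = k + 1" | "k + 1 < i" "i \<le> 2 * k" | "i = 2 * k + 1" "k + 1 < i"
      using i by linarith
    then have "{f i, f (Suc i mod (2 * k + 2))} \<in> E"
    proof cases
      case 1
      then show ?thesis using z \<open>k \<noteq> 0\<close> by (simp add: f_def)
    next
      case 2
      then show ?thesis
        using step[of z "i - 1"] z k(3) by (simp add: f_def m_def)
    next
      case 3
      show ?thesis
      proof (cases "k = 1")
        case True
        then show ?thesis
          using 3 step[of z' 0] k mz' z' by (simp add: f_def insert_commute)
      next
        case False
        then show ?thesis
          using 3 step[of z' "k - 1"] k mz' z' \<open>k \<noteq> 0\<close> by (simp add: f_def insert_commute)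
      qed
    next
      case 4
      then have "2 * k + 1 - i = Suc (2 * k - i)" by simp
      then show ?thesis
        using 4 step[of z' "2 * k - i"] k(3) mz' z' by (simp add: f_def insert_commute)
    next
      case 5
      then show ?thesis using z' by (simp add: f_def insert_commute)
    qed
    then show ?thesis using nth[OF i] nth[of "Suc i mod (2 * k + 2)"] len by simp
  qed
  ultimately have "graph_cycle E xs"
    using \<open>k \<noteq> 0\<close> by (simp add: graph_cycle_def len)
  then show False using tree by (auto simp: simplicial_tree_def)
qed

lemma tree_metric_graph_dist: "tree_metric V (graph_dist E)"
proof
  show eq: "graph_dist E x y = 0 \<longleftrightarrow> x = y" if "x \<in> V" "y \<in> V" for x y
    by (rule graph_dist_0[OF that])
  show sym: "graph_dist E x y = graph_dist E y x" if "x \<in> V" "y \<in> V" for x y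
    using graph_dist_walk that walk_sym graph_dist_le by (metis le_antisym)
  show "graph_dist E x z \<le> graph_dist E x y + graph_dist E y z" if "x \<in> V" "y \<in> V" "z \<in> V" for x y z
    by (rule graph_dist_triangle[OF that])
  show "graph_dist E x z = graph_dist E x y + 1 \<or> graph_dist E x y = graph_dist E x z + 1"
    if V: "x \<in> V" "y \<in> V" "z \<in> V" and 1: "graph_dist E y z = 1" for x y z
  proof -
    have "graph_dist E z y = 1" using 1 sym V by simp
    then have "graph_dist E x z \<le> graph_dist E x y + 1" "graph_dist E x y \<le> graph_dist E x z + 1"
      using graph_dist_triangle[of x y z] graph_dist_triangle[of x z y] V 1 by auto
    moreover have "{y, z} \<in> E" using 1 graph_dist_1 V by blast
    then have "even (graph_dist E x y) \<noteq> even (graph_dist E x z)"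
      using walk_parity[OF graph_dist_walk[of x y]] walk_parity[OF graph_dist_walk[of x z]] V
        bipartition_unordered(1)[OF bip, of y z] by blast
    then have "graph_dist E x y \<noteq> graph_dist E x z" by auto
    ultimately show ?thesis by linarith
  qed
  show "\<exists>z\<in>V. graph_dist E y z = 1 \<and> graph_dist E x z + 1 = graph_dist E x y" if V: "x \<in> V" "y \<in> V" and ne: "x \<noteq> y" for x y
  proof -
    obtain n where n: "graph_dist E x y = Suc n" using eq V ne by (metis not0_implies_Suc)
    then obtain z where z: "(x, z) \<in> adjacency E ^^ n" "(z, y) \<in> adjacency E"
      using graph_dist_walk[OF V] by (metis relpow_Suc_E)
    then have zV: "z \<in> V" "{y, z} \<in> E"
      using bipartition_unordered[OF bip] by (auto simp: insert_commute)
    then have yz: "graph_dist E y z = 1" "graph_dist E z y = 1" using graph_dist_1 V sym by auto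
    have "graph_dist E x z \<le> n" "graph_dist E x y \<le> graph_dist E x z + graph_dist E z y"
      using graph_dist_le z graph_dist_triangle V zV by auto
    then show ?thesis using n yz zV by force
  qed
  show "z = z'" if "x \<in> V" "y \<in> V" "z \<in> V" "z' \<in> V" "graph_dist E y z = 1" "graph_dist E y z' = 1"
      "graph_dist E x z + 1 = graph_dist E x y" "graph_dist E x z' + 1 = graph_dist E x y" for x y z z'
    by (rule graph_predecessor_unique[of x y]) (use that graph_dist_1 in auto)
qed

text \<open>Walks are carried to walks, so distances do not increase; applying this to
  \<open>- g\<close> gives equality.\<close>

lemma graph_dist_act:
  assumes act: "simplicial_action V E act" and V: "x \<in> V" "y \<in> V"
  shows "graph_dist E (act g x) (act g y) = graph_dist E x y"
proof -
  have actV: "act g v \<in> V" "act (- g) (act g v) = v" if "v \<in> V" for g v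
  proof -
    have "act (- g + g) v = act (- g) (act g v)" "act 0 v = v" "act g v \<in> V"
      using act that unfolding simplicial_action_def by blast+
    then show "act g v \<in> V" "act (- g) (act g v) = v" by simp_all
  qed
  have walk: "(x, y) \<in> adjacency E ^^ n \<Longrightarrow> (act g x, act g y) \<in> adjacency E ^^ n" for n g x y
  proof (induction n arbitrary: y)
    case (Suc n)
    then obtain z where z: "(x, z) \<in> adjacency E ^^ n" "{z, y} \<in> E" by auto
    then have "act g ` {z, y} \<in> E" using act unfolding simplicial_action_def by blast
    then have "(act g z, act g y) \<in> adjacency E" by simp
    then show ?case using Suc.IH[OF z(1)] by auto
  qed simp
  have le: "graph_dist E (act g x) (act g y) \<le> graph_dist E x y" if "x \<in> V" "y \<in> V" for g x y
    by (rule graph_dist_le, rule walk, rule graph_dist_walk[OF that])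
  show ?thesis
    using le[OF V, of g] le[of "act g x" "act g y" "- g"] actV V by simp
qed

lemma tree_action_graph_dist:
  assumes act: "simplicial_action V E act"
  shows "tree_action V (graph_dist E) act"
proof -
  interpret tree_metric V "graph_dist E" by (rule tree_metric_graph_dist)
  show ?thesis
    by unfold_locales (use act graph_dist_act[OF act] in \<open>auto simp: simplicial_action_def\<close>)
qed

lemma graph_dist_act_neq_1:
  assumes "\<And>g. act g ` A = A" "\<And>g. act g ` B = B" and x: "x \<in> V" "act g x \<in> V"
  shows "graph_dist E x (act g x) \<noteq> 1"
proof
  assume "graph_dist E x (act g x) = 1"
  then have "{x, act g x} \<in> E" using graph_dist_1 x by blast
  then have "x \<in> A \<longleftrightarrow> act g x \<notin> A" using bipartition_unordered(1)[OF bip] by blast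
  moreover have "x \<in> A \<or> x \<in> B" "A \<inter> B = {}" using bip x by (auto simp: bipartition_def)
  ultimately show False using assms(1,2)[of g] by blast
qed

end

section \<open>Haar measure\<close>

locale haar_group =
  fixes \<mu> :: "'g::{topological_group_add, t2_space} measure"
  assumes haar: "left_haar_measure \<mu>"
begin

section \<open>Regularity and Steinhaus' theorem\<close>

lemma sets_haar [simp, measurable_cong]: "sets \<mu> = sets borel"
  using haar by (simp add: left_haar_measure_def)

lemma space_haar [simp]: "space \<mu> = UNIV"
  using sets_eq_imp_space_eq[OF sets_haar] by simp

lemma emeasure_compact_finite: "compact K \<Longrightarrow> emeasure \<mu> K \<noteq> \<infinity>"
  using haar unfolding left_haar_measure_def by (metis order_less_irrefl)

lemma emeasure_translate: "A \<in> sets borel \<Longrightarrow> emeasure \<mu> ((+) g ` A) = emeasure \<mu> A"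
  using haar unfolding left_haar_measure_def by blast

lemma open_superset:
  assumes "A \<in> sets borel" "emeasure \<mu> A < c"
  shows "\<exists>U. open U \<and> A \<subseteq> U \<and> emeasure \<mu> U < c"
proof -
  have "emeasure \<mu> A = (INF U\<in>{U. open U \<and> A \<subseteq> U}. emeasure \<mu> U)"
    using haar assms(1) unfolding left_haar_measure_def by blast
  then show ?thesis using assms(2) by (auto simp: INF_less_iff)
qed

lemma compact_subset_open:
  assumes "open U" "c < emeasure \<mu> U"
  shows "\<exists>K. compact K \<and> K \<subseteq> U \<and> c < emeasure \<mu> K"
proof -
  have "emeasure \<mu> U = (SUP K\<in>{K. compact K \<and> K \<subseteq> U}. emeasure \<mu> K)"
    using haar assms(1) unfolding left_haar_measure_def by blast
  then show ?thesis using assms(2) by (auto simp: less_SUP_iff)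
qed

lemma open_superset_measure:
  assumes A: "A \<in> sets borel" "emeasure \<mu> A \<noteq> \<infinity>" and "0 < e"
  shows "\<exists>U. open U \<and> A \<subseteq> U \<and> emeasure \<mu> U \<noteq> \<infinity> \<and> measure \<mu> U < measure \<mu> A + e"
proof -
  have eq: "emeasure \<mu> A = ennreal (measure \<mu> A)" using A emeasure_eq_ennreal_measure by auto
  then have "emeasure \<mu> A < ennreal (measure \<mu> A + e)"
    using \<open>0 < e\<close> by (simp add: ennreal_less_iff)
  then obtain U where U: "open U" "A \<subseteq> U" "emeasure \<mu> U < ennreal (measure \<mu> A + e)"
    using open_superset[OF A(1)] by blast
  then have fin: "emeasure \<mu> U \<noteq> \<infinity>" by auto
  then have "ennreal (measure \<mu> U) < ennreal (measure \<mu> A + e)"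
    using U(3) emeasure_eq_ennreal_measure[of \<mu> U] by simp
  then have "measure \<mu> U < measure \<mu> A + e"
    by (simp add: ennreal_less_iff del: ennreal_plus)
  then show ?thesis using U fin by blast
qed

text \<open>Inner regularity is given only for open sets. Inside the compact \<open>C\<close>, an
  open \<open>U\<close> around \<open>C - A\<close> with excess below \<open>measure \<mu> A\<close>
  leaves the compact set \<open>C - U\<close>, which lies in \<open>A\<close> and has positive
  measure.\<close>

lemma compact_subset_borel:
  assumes A: "A \<in> sets borel" "A \<subseteq> C" "compact C" and pos: "0 < emeasure \<mu> A"
  shows "\<exists>K. compact K \<and> K \<subseteq> A \<and> 0 < emeasure \<mu> K"
proof -
  have C: "C \<in> sets borel" "emeasure \<mu> C \<noteq> \<infinity>"
    using A(3) borel_compact emeasure_compact_finite by blast+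
  have CA: "C - A \<in> sets borel" "emeasure \<mu> (C - A) \<noteq> \<infinity>"
    using A C emeasure_mono[of "C - A" C \<mu>] by (auto simp: top_unique)
  have A_fin: "emeasure \<mu> A \<noteq> \<infinity>"
    using A C emeasure_mono[of A C \<mu>] by (auto simp: top_unique)
  then have "0 < measure \<mu> A" using pos A_fin by (simp add: measure_def enn2real_positive_iff less_top)
  then obtain U where U: "open U" "C - A \<subseteq> U" "emeasure \<mu> U \<noteq> \<infinity>" "measure \<mu> U < measure \<mu> (C - A) + measure \<mu> A"
    using open_superset_measure[OF CA] by blast
  have "measure \<mu> (C - A) + measure \<mu> A = measure \<mu> C"
    using measure_Diff[of \<mu> C A] C A by simp
  then have "measure \<mu> U < measure \<mu> C" using U(4) by simp
  then have "ennreal (measure \<mu> U) < ennreal (measure \<mu> C)" by (simp add: ennreal_less_iff)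
  then have "emeasure \<mu> U < emeasure \<mu> C"
    using U(3) C(2) by (simp add: emeasure_eq_ennreal_measure)
  moreover have "emeasure \<mu> C \<le> emeasure \<mu> (C - U) + emeasure \<mu> U"
    using emeasure_subadditive[of "C - U" \<mu> U] emeasure_mono[of C "(C - U) \<union> U" \<mu>] C U by auto
  ultimately have "0 < emeasure \<mu> (C - U)"
    by (metis add_0 not_gr_zero not_less)
  then show ?thesis
    using compact_diff[OF A(3) U(1)] U(2) by blast
qed

lemma open_translate:
  fixes U :: "'g set"
  assumes "open U"
  shows "open ((+) g ` U)"
proof -
  have "(+) g ` U = (\<lambda>x. - g + x) -` U"
    by (force simp: image_iff add.assoc[symmetric] intro: bexI[of _ "- g + _"])
  moreover have "open ((\<lambda>x. - g + x) -` U)"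
    by (intro open_vimage assms continuous_intros)
  ultimately show ?thesis by simp
qed

lemma compact_translate:
  fixes K :: "'g set"
  shows "compact K \<Longrightarrow> compact ((+) g ` K)"
  by (rule compact_continuous_image) (auto intro!: continuous_intros)

lemma emeasure_UNIV_pos: "0 < emeasure \<mu> UNIV"
proof -
  have "emeasure \<mu> UNIV \<noteq> 0" using haar unfolding left_haar_measure_def by blast
  then show ?thesis by (simp add: zero_less_iff_neq_zero)
qed

text \<open>Otherwise finitely many null translates of \<open>U\<close> would cover a compact set of
  positive measure.\<close>

lemma emeasure_open_pos:
  assumes "open U" "x \<in> U"
  shows "0 < emeasure \<mu> U"
proof (rule ccontr)
  assume "\<not> ?thesis"
  then have U0: "emeasure \<mu> U = 0" by simp
  obtain K where K: "compact K" "0 < emeasure \<mu> K"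
    using compact_subset_open[OF open_UNIV emeasure_UNIV_pos] by blast
  have "k \<in> (+) (k + - x) ` U" for k
    using assms(2) by (force simp: image_iff add.assoc intro: bexI[of _ x])
  then have "K \<subseteq> (\<Union>g\<in>UNIV. (+) g ` U)" by blast
  then obtain I where I: "finite I" "K \<subseteq> (\<Union>g\<in>I. (+) g ` U)"
    using compactE_image[OF K(1), of UNIV "\<lambda>g. (+) g ` U"] open_translate[OF assms(1)] by metis
  have "emeasure \<mu> K \<le> emeasure \<mu> (\<Union>g\<in>I. (+) g ` U)"
    by (rule emeasure_mono[OF I(2)]) (use open_translate[OF assms(1)] in \<open>auto intro!: borel_open\<close>)
  also have "\<dots> \<le> (\<Sum>g\<in>I. emeasure \<mu> ((+) g ` U))"
    by (rule emeasure_subadditive_finite) (use I open_translate[OF assms(1)] in \<open>auto intro!: borel_open\<close>)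
  also have "\<dots> = 0" using U0 assms(1) emeasure_translate by simp
  finally show False using K by simp
qed

lemma small_translates:
  fixes K :: "'g set"
  assumes "compact K" "open U" "K \<subseteq> U"
  shows "\<exists>P. open P \<and> 0 \<in> P \<and> (\<forall>h\<in>P. (+) h ` K \<subseteq> U)"
proof -
  define W where "W = (\<lambda>p. fst p + snd p) -` U"
  have "open W"
    unfolding W_def by (intro open_vimage assms continuous_intros)
  moreover have "{0} \<times> K \<subseteq> W" using assms(3) by (auto simp: W_def)
  ultimately have "\<exists>P. 0 \<in> P \<and> open P \<and> P \<times> K \<subseteq> W"
    by (rule Elementary_Topology.tube_lemma[OF assms(1)])
  then obtain P where "0 \<in> P" "open P" "P \<times> K \<subseteq> (\<lambda>p. fst p + snd p) -` U"
    unfolding W_def by blast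
  then show ?thesis by (intro exI[of _ P]) auto
qed

text \<open>Choose an open \<open>U\<close> around \<open>K\<close> of measure less than twice that
  of \<open>K\<close>; a small translate of \<open>K\<close> stays inside \<open>U\<close>, which
  has no room for two disjoint copies.\<close>

lemma steinhaus:
  assumes K: "compact K" "0 < emeasure \<mu> K"
  shows "\<exists>P. open P \<and> 0 \<in> P \<and> (\<forall>h\<in>P. (+) h ` K \<inter> K \<noteq> {})"
proof -
  have Kb: "K \<in> sets borel" "emeasure \<mu> K \<noteq> \<infinity>"
    using K borel_compact emeasure_compact_finite by blast+
  then have "0 < measure \<mu> K" using K by (simp add: measure_def enn2real_positive_iff less_top)
  then obtain U where U: "open U" "K \<subseteq> U" "emeasure \<mu> U \<noteq> \<infinity>" "measure \<mu> U < measure \<mu> K + measure \<mu> K"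
    using open_superset_measure[OF Kb] by blast
  obtain P where P: "open P" "0 \<in> P" "\<And>h. h \<in> P \<Longrightarrow> (+) h ` K \<subseteq> U"
    using small_translates[OF K(1) U(1,2)] by blast
  have "(+) h ` K \<inter> K \<noteq> {}" if "h \<in> P" for h
  proof
    assume dis: "(+) h ` K \<inter> K = {}"
    have hK: "(+) h ` K \<in> sets borel"
      using compact_translate[OF K(1)] borel_compact by blast
    have "emeasure \<mu> K + emeasure \<mu> K = emeasure \<mu> ((+) h ` K \<union> K)"
      using plus_emeasure[of "(+) h ` K" \<mu> K] dis hK Kb emeasure_translate by simp
    also have "\<dots> \<le> emeasure \<mu> U"
      by (rule emeasure_mono) (use P that U in auto)
    finally have "ennreal (measure \<mu> K) + ennreal (measure \<mu> K) \<le> ennreal (measure \<mu> U)"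
      using Kb U emeasure_eq_ennreal_measure[of \<mu>] by simp
    then have "measure \<mu> K + measure \<mu> K \<le> measure \<mu> U"
      by (simp flip: ennreal_plus)
    then show False using U by simp
  qed
  then show ?thesis using P by blast
qed

section \<open>Locally null sets\<close>

definition locally_null :: "'g set \<Rightarrow> bool" where
  "locally_null A \<longleftrightarrow> (\<forall>C. compact C \<longrightarrow> (\<exists>Z\<in>null_sets \<mu>. A \<inter> C \<subseteq> Z))"

lemma locally_null_subset: "\<lbrakk>locally_null B; A \<subseteq> B\<rbrakk> \<Longrightarrow> locally_null A"
  unfolding locally_null_def by (meson Int_mono order_refl order_trans)

lemma locally_null_empty [simp]: "locally_null {}"
  unfolding locally_null_def by auto

lemma locally_null_UN:
  assumes "countable I" "\<And>i. i \<in> I \<Longrightarrow> locally_null (A i)"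
  shows "locally_null (\<Union>i\<in>I. A i)"
  unfolding locally_null_def
proof (intro allI impI)
  fix C :: "'g set" assume "compact C"
  then have "\<forall>i\<in>I. \<exists>Z\<in>null_sets \<mu>. A i \<inter> C \<subseteq> Z"
    using assms(2) by (auto simp: locally_null_def)
  then obtain Z where Z: "\<And>i. i \<in> I \<Longrightarrow> Z i \<in> null_sets \<mu>" "\<And>i. i \<in> I \<Longrightarrow> A i \<inter> C \<subseteq> Z i"
    by metis
  then show "\<exists>Z\<in>null_sets \<mu>. (\<Union>i\<in>I. A i) \<inter> C \<subseteq> Z"
    by (intro bexI[of _ "\<Union>i\<in>I. Z i"] null_sets_UN'[OF assms(1)]) blast+
qed

lemma locally_null_translate:
  assumes "locally_null A"
  shows "locally_null ((+) g ` A)"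
  unfolding locally_null_def
proof (intro allI impI)
  fix C :: "'g set" assume "compact C"
  then obtain Z where Z: "Z \<in> null_sets \<mu>" "A \<inter> (+) (- g) ` C \<subseteq> Z"
    using assms compact_translate by (meson locally_null_def)
  have "(+) g ` Z = (\<lambda>x. - g + x) -` Z"
    by (force simp: image_iff add.assoc[symmetric] intro: bexI[of _ "- g + _"])
  moreover have "(\<lambda>x. - g + x) \<in> borel_measurable borel"
    by (intro borel_measurable_continuous_onI continuous_intros)
  ultimately have "(+) g ` Z \<in> sets borel"
    using Z(1) measurable_sets_borel[of "\<lambda>x. - g + x" borel Z] by (auto simp: null_sets_def)
  then have "(+) g ` Z \<in> null_sets \<mu>"
    using Z(1) emeasure_translate by (auto simp: null_sets_def)
  moreover have "(+) g ` A \<inter> C \<subseteq> (+) g ` Z"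
  proof
    fix x assume "x \<in> (+) g ` A \<inter> C"
    then obtain a where a: "a \<in> A" "x = g + a" "x \<in> C" by auto
    then have "a \<in> (+) (- g) ` C" by (auto simp: image_iff add.assoc[symmetric] intro!: bexI[of _ x])
    then show "x \<in> (+) g ` Z" using a Z(2) by blast
  qed
  ultimately show "\<exists>Z\<in>null_sets \<mu>. (+) g ` A \<inter> C \<subseteq> Z" by blast
qed

lemma not_locally_null_UNIV: "\<not> locally_null UNIV"
proof
  assume ln: "locally_null UNIV"
  obtain K where K: "compact K" "0 < emeasure \<mu> K"
    using compact_subset_open[OF open_UNIV emeasure_UNIV_pos] by blast
  then obtain Z where "Z \<in> null_sets \<mu>" "K \<subseteq> Z" using ln by (auto simp: locally_null_def)
  then show False using K emeasure_mono[of K Z \<mu>] by (auto simp: null_sets_def)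
qed

text \<open>A set measurable for the completion is Borel up to a subset of a null set. If the Borel
  part has positive measure on some compact set, \<open>compact_subset_borel\<close> applies;
  otherwise it is null on all of them.\<close>

lemma haar_measurable_dichotomy:
  assumes "haar_measurable \<mu> A"
  shows "locally_null A \<or> (\<exists>K. compact K \<and> K \<subseteq> A \<and> 0 < emeasure \<mu> K)"
proof -
  obtain S N N' where S: "A = S \<union> N" "N \<subseteq> N'" "N' \<in> null_sets \<mu>" "S \<in> sets \<mu>"
    using assms sets_completionE[of A \<mu>] by (auto simp: haar_measurable_def)
  show ?thesis
  proof (cases "\<exists>C. compact C \<and> 0 < emeasure \<mu> (S \<inter> C)")
    case True
    then obtain C where C: "compact C" "0 < emeasure \<mu> (S \<inter> C)" by blast
    have "S \<inter> C \<in> sets borel" using S(4) borel_compact[OF C(1)] by auto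
    then show ?thesis using compact_subset_borel[of "S \<inter> C" C] C S(1) by blast
  next
    case False
    have "locally_null A"
      unfolding locally_null_def
    proof (intro allI impI)
      fix C :: "'g set" assume C: "compact C"
      then have "S \<inter> C \<in> sets \<mu>" using S(4) borel_compact[OF C] by auto
      then have "S \<inter> C \<union> N' \<in> null_sets \<mu>"
        using False C S(3) by (auto simp: null_sets_def intro!: emeasure_Un_null_set[THEN trans])
      moreover have "A \<inter> C \<subseteq> S \<inter> C \<union> N'" unfolding S(1) using S(2) by blast
      ultimately show "\<exists>Z\<in>null_sets \<mu>. A \<inter> C \<subseteq> Z" by (rule bexI[rotated])
    qed
    then show ?thesis ..
  qed
qed

section \<open>Measure estimates for Dudley's argument\<close>

lemma measure_translate_diff:
  fixes Y :: "'g set"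
  assumes "compact Y" "open U" "(+) h ` Y \<subseteq> U"
  shows "emeasure \<mu> {g \<in> Y. h + g \<notin> Y} \<le> emeasure \<mu> (U - Y)"
proof -
  have Yb: "Y \<in> sets borel" "(+) h ` Y \<in> sets borel" "(+) (- h) ` Y \<in> sets borel" "U \<in> sets borel"
    using assms compact_translate borel_compact borel_open by blast+
  have eq: "{g \<in> Y. h + g \<notin> Y} = Y - (+) (- h) ` Y"
    by (auto simp: image_iff add.assoc[symmetric]) (metis add.assoc add.right_inverse add_0)
  \<comment> \<open>By invariance the part of \<open>Y\<close> pushed out of \<open>Y\<close> has
    the measure of its image, which lies in \<open>U - Y\<close>.\<close>
  then have "emeasure \<mu> {g \<in> Y. h + g \<notin> Y} = emeasure \<mu> ((+) h ` {g \<in> Y. h + g \<notin> Y})"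
    using Yb emeasure_translate by (metis sets.Diff)
  also have "\<dots> \<le> emeasure \<mu> (U - Y)"
    by (rule emeasure_mono) (use assms(3) Yb in auto)
  finally show ?thesis .
qed

text \<open>
  An elementary form of Tonelli's theorem: \<open>{(y, g). w y + g \<in> Y}\<close> need not be measurable for
  the product of the Borel \<open>\<sigma>\<close>-algebras, and \<open>A\<close> need not be measurable at all.
\<close>

lemma section_not_null:
  fixes Y V A :: "'g set"
  assumes Y: "compact Y" and V: "compact V" "0 < emeasure \<mu> V" and w: "continuous_on UNIV w"
    and A: "A \<subseteq> Y" and e: "0 < e" and thick: "\<And>U. \<lbrakk>open U; A \<subseteq> U\<rbrakk> \<Longrightarrow> ennreal e \<le> emeasure \<mu> U"
    and U: "open U" "Y \<subseteq> U" "emeasure \<mu> U \<noteq> \<infinity>" "measure \<mu> U < measure \<mu> Y + e / 4"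
    and wU: "\<And>y. y \<in> V \<Longrightarrow> (+) (w y) ` Y \<subseteq> U"
  shows "\<exists>g\<in>A. emeasure \<mu> {y \<in> V. w y + g \<in> Y} \<noteq> 0"
proof (rule ccontr)
  assume "\<not> ?thesis"
  then have null: "emeasure \<mu> {y \<in> V. w y + g \<in> Y} = 0" if "g \<in> A" for g
    using that by blast
  have Yb: "Y \<in> sets borel" "emeasure \<mu> Y \<noteq> \<infinity>" and Vb: "V \<in> sets borel" "emeasure \<mu> V \<noteq> \<infinity>"
    using Y V borel_compact emeasure_compact_finite by blast+
  have mV: "0 < measure \<mu> V"
    using V(2) Vb by (simp add: measure_def enn2real_positive_iff less_top)
  have "continuous_on UNIV (\<lambda>p. w (snd p) + fst p)"
    by (intro continuous_intros continuous_on_compose2[OF w]) auto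
  then have opW: "open ((\<lambda>p. w (snd p) + fst p) -` (- Y))"
    by (intro open_vimage open_Compl compact_imp_closed Y)
  \<comment> \<open>Small enough that integrating the covers \<open>B g\<close> gives at most
    \<open>e / 8 * measure \<mu> V\<close>; the summand 1 keeps the denominator positive.\<close>
  define \<eta> where "\<eta> = e * measure \<mu> V / (8 * (measure \<mu> Y + 1))"
  have \<eta>: "0 < \<eta>" using e mV by (simp add: \<eta>_def add_nonneg_pos)
  have "\<exists>O'. open O' \<and> {y \<in> V. w y + g \<in> Y} \<subseteq> O' \<and> emeasure \<mu> O' < ennreal \<eta>" if g: "g \<in> A" for g
  proof (rule open_superset)
    have "closed ((\<lambda>y. w y + g) -` Y)"
      by (intro closed_vimage compact_imp_closed Y continuous_intros w)
    then have "{y \<in> V. w y + g \<in> Y} = V \<inter> (\<lambda>y. w y + g) -` Y \<and> (\<lambda>y. w y + g) -` Y \<in> sets borel"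
      using borel_closed by blast
    then show "{y \<in> V. w y + g \<in> Y} \<in> sets borel" using sets.Int[OF Vb(1)] by simp
    show "emeasure \<mu> {y \<in> V. w y + g \<in> Y} < ennreal \<eta>" using null[OF g] \<eta> by simp
  qed
  then obtain B where B: "\<And>g. g \<in> A \<Longrightarrow> open (B g)" "\<And>g. g \<in> A \<Longrightarrow> {y \<in> V. w y + g \<in> Y} \<subseteq> B g"
      "\<And>g. g \<in> A \<Longrightarrow> emeasure \<mu> (B g) < ennreal \<eta>"
    by metis
  \<comment> \<open>Off \<open>B g\<close> the remaining \<open>y\<close> form a compact set, so by
    the tube lemma one neighbourhood of \<open>g\<close> serves all of them.\<close>
  have "\<exists>X. g \<in> X \<and> open X \<and> (\<forall>g'\<in>X. \<forall>y\<in>V - B g. w y + g' \<notin> Y)" if g: "g \<in> A" for g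
  proof -
    have "{g} \<times> (V - B g) \<subseteq> (\<lambda>p. w (snd p) + fst p) -` (- Y)" using B(2)[OF g] by auto
    then obtain X where X: "g \<in> X" "open X" "X \<times> (V - B g) \<subseteq> (\<lambda>p. w (snd p) + fst p) -` (- Y)"
      using Elementary_Topology.tube_lemma[OF compact_diff[OF V(1) B(1)[OF g]] opW] by blast
    then show ?thesis by (intro exI[of _ X]) auto
  qed
  then obtain X where X: "\<And>g. g \<in> A \<Longrightarrow> g \<in> X g" "\<And>g. g \<in> A \<Longrightarrow> open (X g)"
      "\<And>g g' y. \<lbrakk>g \<in> A; g' \<in> X g; y \<in> V - B g\<rbrakk> \<Longrightarrow> w y + g' \<notin> Y"
    by metis
  have "open ((\<Union>g\<in>A. X g) \<inter> U)" "A \<subseteq> (\<Union>g\<in>A. X g) \<inter> U"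
    using X U A by blast+
  \<comment> \<open>Although \<open>A\<close> may be non-measurable, its open neighbourhood has
    measure at least \<open>e\<close>, and inner regularity passes to a compact
    \<open>K\<close>.\<close>
  then have "ennreal e \<le> emeasure \<mu> ((\<Union>g\<in>A. X g) \<inter> U)" by (rule thick)
  moreover have "ennreal (3 * e / 4) < ennreal e" using e by (simp add: ennreal_less_iff)
  ultimately obtain K where K: "compact K" "K \<subseteq> (\<Union>g\<in>A. X g) \<inter> U" "ennreal (3 * e / 4) < emeasure \<mu> K"
    using compact_subset_open[OF \<open>open ((\<Union>g\<in>A. X g) \<inter> U)\<close>] by (meson less_le_trans)
  obtain I where I: "finite I" "I \<subseteq> A" "K \<subseteq> (\<Union>g\<in>I. X g)"
    using compactE_image[OF K(1), of A X] X(2) K(2) by (metis Int_subset_iff)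
  have Ub: "U \<in> sets borel" using U(1) by (rule borel_open)
  have Kb: "K \<in> sets borel" "emeasure \<mu> K \<noteq> \<infinity>"
    using K(1) borel_compact emeasure_compact_finite by blast+
  have UY: "measure \<mu> (U - Y) < e / 4"
    using measure_Diff[of \<mu> U Y] U Yb Ub by simp
  have UYfin: "emeasure \<mu> (U - Y) \<noteq> \<infinity>"
    using U(3) emeasure_mono[of "U - Y" U \<mu>] Ub by (auto simp: top_unique)
  have subY: "emeasure \<mu> S \<noteq> \<infinity>" if "S \<subseteq> Y" for S
    using Yb emeasure_mono[OF that, of \<mu>] by (auto simp: top_unique)
  then have KYfin: "emeasure \<mu> (K \<inter> Y) \<noteq> \<infinity>" by simp
  \<comment> \<open>Less than \<open>e / 4\<close> is lost outside \<open>Y\<close>, so more than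
    \<open>e / 2\<close> remains of the \<open>3 * e / 4\<close>.\<close>
  have "measure \<mu> K \<le> measure \<mu> (K \<inter> Y) + measure \<mu> (U - Y)"
  proof -
    have "emeasure \<mu> ((K \<inter> Y) \<union> (U - Y)) \<le> emeasure \<mu> U"
      by (rule emeasure_mono) (use U(2) K(2) Ub in auto)
    then have "(K \<inter> Y) \<union> (U - Y) \<in> fmeasurable \<mu>"
      using U(3) Kb Yb Ub by (auto simp: fmeasurable_def less_top top_unique)
    then have "measure \<mu> K \<le> measure \<mu> ((K \<inter> Y) \<union> (U - Y))"
      by (intro measure_mono_fmeasurable) (use K(2) Kb in auto)
    also have "\<dots> \<le> measure \<mu> (K \<inter> Y) + measure \<mu> (U - Y)"
      by (rule measure_subadditive) (use Kb Yb Ub UYfin KYfin in auto)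
    finally show ?thesis .
  qed
  moreover have "3 * e / 4 < measure \<mu> K"
    using K(3) Kb(2) e by (simp add: emeasure_eq_ennreal_measure ennreal_less_iff)
  ultimately have KY: "e / 2 < measure \<mu> (K \<inter> Y)" using UY by simp
  obtain n gs where gs: "I = gs ` {i::nat. i < n}" "inj_on gs {i. i < n}"
    using finite_imp_inj_to_nat_seg[OF I(1)] by (metis finite_imp_nat_seg_image_inj_on I(1))
  have gsA: "gs i \<in> A" if "i < n" for i using gs(1) I(2) that by blast
  \<comment> \<open>The finite cover is made disjoint, so that the measures of its pieces add
    up.\<close>
  define P where "P i = K \<inter> Y \<inter> (X (gs i) - (\<Union>j<i. X (gs j)))" for i
  have Pb: "P i \<in> sets borel" if "i < n" for i
  proof -
    have "open (X (gs j))" if "j \<le> i" for j using X(2) gsA \<open>i < n\<close> that by simp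
    then show ?thesis unfolding P_def
      by (intro sets.Int sets.Diff sets.finite_UN Kb Yb borel_open) auto
  qed
  have Pdis: "disjoint_family_on P {..<n}"
    unfolding disjoint_family_on_def P_def by (auto simp: linorder_neq_iff)
  have Pcov: "K \<inter> Y = (\<Union>i<n. P i)"
  proof
    show "K \<inter> Y \<subseteq> (\<Union>i<n. P i)"
    proof
      fix k assume k: "k \<in> K \<inter> Y"
      then have "\<exists>i. i < n \<and> k \<in> X (gs i)" using I(3) gs(1) by blast
      then obtain i where "i < n" "k \<in> X (gs i)" "\<forall>j<i. \<not> (j < n \<and> k \<in> X (gs j))"
        using exists_least_iff[of "\<lambda>i. i < n \<and> k \<in> X (gs i)"] by blast
      then show "k \<in> (\<Union>i<n. P i)" using k by (auto simp: P_def)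
    qed
  qed (auto simp: P_def)
  have Pfin: "emeasure \<mu> (P i) \<noteq> \<infinity>" if "i < n" for i
    by (rule subY) (auto simp: P_def)
  have Psum: "(\<Sum>i<n. measure \<mu> (P i)) = measure \<mu> (K \<inter> Y)"
    unfolding Pcov
    by (rule measure_finite_Union[symmetric]) (use Pb Pdis Pfin in auto)
  \<comment> \<open>For fixed \<open>y\<close>, pieces with \<open>y\<close> outside
    \<open>B (gs i)\<close> are pushed out of \<open>Y\<close> by \<open>w y\<close>; they make up
    less than \<open>e / 4\<close>, so the other pieces carry at least \<open>e / 4\<close>.\<close>
  have point: "e / 4 \<le> (\<Sum>i<n. measure \<mu> (P i) * indicator (B (gs i)) y)" if y: "y \<in> V" for y
  proof -
    define D where "D = {g \<in> Y. w y + g \<notin> Y}"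
    define J where "J = {i. i < n \<and> y \<in> B (gs i)}"
    have D: "emeasure \<mu> D \<le> emeasure \<mu> (U - Y)"
      unfolding D_def by (rule measure_translate_diff[OF Y U(1) wU[OF y]])
    have "continuous_on UNIV (\<lambda>g. w y + g)" by (intro continuous_intros)
    then have "closed ((\<lambda>g. w y + g) -` Y)"
      by (intro closed_vimage compact_imp_closed Y)
    moreover have "D = Y - (\<lambda>g. w y + g) -` Y" by (auto simp: D_def)
    ultimately have Db: "D \<in> sets borel" using Yb(1) borel_closed by blast
    have Dfin: "emeasure \<mu> D \<noteq> \<infinity>" using D UYfin by (auto simp: top_unique)
    have Dm: "measure \<mu> D \<le> measure \<mu> (U - Y)"
      unfolding measure_def using D UYfin by (intro enn2real_mono) (auto simp: less_top)
    have J: "finite J" "J \<subseteq> {..<n}" by (auto simp: J_def)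
    have cov: "K \<inter> Y \<subseteq> D \<union> (\<Union>i\<in>J. P i)"
    proof
      fix k assume k: "k \<in> K \<inter> Y"
      then obtain i where i: "i < n" "k \<in> P i" using Pcov by auto
      show "k \<in> D \<union> (\<Union>i\<in>J. P i)"
      proof (cases "y \<in> B (gs i)")
        case True
        then show ?thesis using i by (auto simp: J_def)
      next
        case False
        then have "w y + k \<notin> Y" using X(3)[OF gsA[OF i(1)]] i(2) y by (auto simp: P_def)
        then show ?thesis using k by (auto simp: D_def)
      qed
    qed
    have JPb: "(\<Union>i\<in>J. P i) \<in> sets borel" using Pb J by (intro sets.finite_UN) auto
    have JPfin: "emeasure \<mu> (\<Union>i\<in>J. P i) \<noteq> \<infinity>"
      by (rule subY) (auto simp: P_def)
    have "measure \<mu> (K \<inter> Y) \<le> measure \<mu> (D \<union> (\<Union>i\<in>J. P i))"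
    proof (rule measure_mono_fmeasurable[OF cov])
      have "emeasure \<mu> (D \<union> (\<Union>i\<in>J. P i)) \<le> emeasure \<mu> Y"
        by (rule emeasure_mono) (use Yb in \<open>auto simp: D_def P_def\<close>)
      then show "D \<union> (\<Union>i\<in>J. P i) \<in> fmeasurable \<mu>"
        using Yb(2) Db JPb by (auto simp: fmeasurable_def less_top top_unique)
    qed (use Kb Yb in auto)
    also have "\<dots> \<le> measure \<mu> D + measure \<mu> (\<Union>i\<in>J. P i)"
      by (rule measure_subadditive) (use Db JPb Dfin JPfin in auto)
    also have "measure \<mu> (\<Union>i\<in>J. P i) \<le> (\<Sum>i\<in>J. measure \<mu> (P i))"
      by (rule measure_subadditive_finite) (use J Pb Pfin in auto)
    also have "(\<Sum>i\<in>J. measure \<mu> (P i)) = (\<Sum>i<n. measure \<mu> (P i) * indicator (B (gs i)) y)"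
      by (rule sum.mono_neutral_cong_left) (use J in \<open>auto simp: J_def\<close>)
    finally show ?thesis using KY Dm UY by simp
  qed
  \<comment> \<open>Integrating \<open>point\<close> over \<open>V\<close> bounds
    \<open>e / 4 * measure \<mu> V\<close> by the weighted measures of the sets
    \<open>B (gs i)\<close>, each below \<open>\<eta>\<close>.\<close>
  have "ennreal (e / 4) * emeasure \<mu> V = (\<integral>\<^sup>+y. ennreal (e / 4) * indicator V y \<partial>\<mu>)"
    using Vb by (simp add: nn_integral_cmult_indicator)
  also have "\<dots> \<le> (\<integral>\<^sup>+y. (\<Sum>i<n. ennreal (measure \<mu> (P i)) * indicator (B (gs i)) y) \<partial>\<mu>)"
  proof (rule nn_integral_mono)
    fix y
    show "ennreal (e / 4) * indicator V y \<le> (\<Sum>i<n. ennreal (measure \<mu> (P i)) * indicator (B (gs i)) y)"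
    proof (cases "y \<in> V")
      case True
      have "ennreal (e / 4) \<le> ennreal (\<Sum>i<n. measure \<mu> (P i) * indicator (B (gs i)) y)"
        using point[OF True] by (rule ennreal_leI)
      also have "\<dots> = (\<Sum>i<n. ennreal (measure \<mu> (P i) * indicator (B (gs i)) y))"
        by (rule sum_ennreal[symmetric]) simp
      also have "\<dots> = (\<Sum>i<n. ennreal (measure \<mu> (P i)) * indicator (B (gs i)) y)"
        by (intro sum.cong refl) (auto simp: indicator_def)
      finally show ?thesis using True by simp
    qed simp
  qed
  also have "\<dots> = (\<Sum>i<n. ennreal (measure \<mu> (P i)) * emeasure \<mu> (B (gs i)))"
  proof -
    have "B (gs i) \<in> sets \<mu>" if "i < n" for i using B(1)[OF gsA[OF that]] borel_open by auto
    then show ?thesis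
      by (subst nn_integral_sum) (auto simp: nn_integral_cmult_indicator)
  qed
  also have "\<dots> \<le> (\<Sum>i<n. ennreal (measure \<mu> (P i)) * ennreal \<eta>)"
    by (intro sum_mono mult_left_mono) (use B(3) gsA in \<open>auto intro: less_imp_le\<close>)
  also have "\<dots> = ennreal (measure \<mu> (K \<inter> Y) * \<eta>)"
    using \<eta> by (simp add: Psum[symmetric] sum_distrib_right[symmetric] ennreal_mult' sum_nonneg)
  also have "ennreal (e / 4) * emeasure \<mu> V = ennreal (e / 4 * measure \<mu> V)"
    using Vb e by (subst ennreal_mult) (simp_all add: emeasure_eq_ennreal_measure)
  finally have "ennreal (e / 4 * measure \<mu> V) \<le> ennreal (measure \<mu> (K \<inter> Y) * \<eta>)" .
  then have "e / 4 * measure \<mu> V \<le> measure \<mu> (K \<inter> Y) * \<eta>"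
    using \<eta> by (subst (asm) ennreal_le_iff) simp_all
  also have "\<dots> \<le> (measure \<mu> Y + 1) * \<eta>"
  proof (rule mult_right_mono)
    have "measure \<mu> (K \<inter> Y) \<le> measure \<mu> Y"
      by (rule measure_mono_fmeasurable) (use Kb Yb in \<open>auto simp: fmeasurable_def less_top\<close>)
    then show "measure \<mu> (K \<inter> Y) \<le> measure \<mu> Y + 1" by simp
  qed (use \<eta> in simp)
  also have "\<dots> = e / 8 * measure \<mu> V"
    using measure_nonneg[of \<mu> Y] by (simp add: \<eta>_def field_simps add_nonneg_eq_0_iff)
  finally show False using e mV by (simp add: mult_less_cancel_right)
qed

text \<open>The sublevel sets exhaust \<open>Y\<close>. If all were thin, open covers with
  geometrically decreasing measures would bound the measure of \<open>Y\<close> by half of itself.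
  Open supersets measure the size because \<open>L\<close> is arbitrary.\<close>

lemma thick_level:
  fixes L :: "'g \<Rightarrow> nat"
  assumes Y: "compact Y" "0 < emeasure \<mu> Y"
  shows "\<exists>M e. 0 < e \<and> (\<forall>U. open U \<longrightarrow> {g \<in> Y. L g \<le> M} \<subseteq> U \<longrightarrow> ennreal e \<le> emeasure \<mu> U)"
proof (rule ccontr)
  assume "\<not> ?thesis"
  then have thin: "\<exists>U. open U \<and> {g \<in> Y. L g \<le> M} \<subseteq> U \<and> emeasure \<mu> U < ennreal e" if "0 < e" for M e
    using that by (meson not_le)
  have Yb: "Y \<in> sets borel" "emeasure \<mu> Y \<noteq> \<infinity>"
    using Y borel_compact emeasure_compact_finite by blast+
  then have mY: "0 < measure \<mu> Y"
    using Y(2) by (simp add: measure_def enn2real_positive_iff less_top)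
  have "\<exists>U. open U \<and> {g \<in> Y. L g \<le> M} \<subseteq> U \<and> emeasure \<mu> U < ennreal (measure \<mu> Y / 2 * (1 / 2) ^ Suc M)" for M
    by (rule thin) (use mY in simp)
  then obtain U where U: "\<And>M. open (U M)" "\<And>M. {g \<in> Y. L g \<le> M} \<subseteq> U M"
      "\<And>M. emeasure \<mu> (U M) < ennreal (measure \<mu> Y / 2 * (1 / 2) ^ Suc M)"
    by metis
  have Ub: "U M \<in> sets \<mu>" for M using U(1) borel_open by auto
  have "Y \<subseteq> (\<Union>M. U M)" using U(2) by blast
  then have "emeasure \<mu> Y \<le> emeasure \<mu> (\<Union>M. U M)"
    by (rule emeasure_mono) (use Ub in auto)
  also have "\<dots> \<le> (\<Sum>M. emeasure \<mu> (U M))"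
    by (rule emeasure_subadditive_countably) (use Ub in auto)
  also have "\<dots> \<le> (\<Sum>M. ennreal (measure \<mu> Y / 2 * (1 / 2) ^ Suc M))"
    by (intro suminf_le summableI) (use U(3) in \<open>auto intro: less_imp_le\<close>)
  also have "\<dots> = ennreal (measure \<mu> Y / 2)"
  proof (rule suminf_ennreal_eq)
    show "(\<lambda>M. measure \<mu> Y / 2 * (1 / 2) ^ Suc M) sums (measure \<mu> Y / 2)"
      using sums_mult[OF power_half_series, of "measure \<mu> Y / 2"] by simp
  qed (use mY in simp)
  finally have "ennreal (measure \<mu> Y) \<le> ennreal (measure \<mu> Y / 2)"
    using Yb by (simp add: emeasure_eq_ennreal_measure)
  then show False using mY by (simp add: ennreal_le_iff)
qed

text \<open>
  The exponent \<open>M\<close> has to dominate the value of the non-measurable function \<open>L\<close> at \<open>g\<close>, so it is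
  chosen first.
\<close>

lemma dudley_step:
  fixes L :: "'g \<Rightarrow> nat" and w :: "nat \<Rightarrow> 'g \<Rightarrow> 'g"
  assumes Y: "compact Y" "0 < emeasure \<mu> Y" and N: "locally_null N"
    and w: "\<And>n. continuous_on UNIV (w n)" "\<And>n. w n 0 = 0"
  shows "\<exists>M g Y'. L g \<le> M \<and> compact Y' \<and> 0 < emeasure \<mu> Y' \<and> Y' \<inter> N = {} \<and> (\<forall>y\<in>Y'. w M y + g \<in> Y)"
proof -
  obtain M e where e: "0 < e"
    and thick: "\<And>U. \<lbrakk>open U; {g \<in> Y. L g \<le> M} \<subseteq> U\<rbrakk> \<Longrightarrow> ennreal e \<le> emeasure \<mu> U"
    using thick_level[OF Y] by metis
  have Yb: "Y \<in> sets borel" "emeasure \<mu> Y \<noteq> \<infinity>"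
    using Y borel_compact emeasure_compact_finite by blast+
  obtain U where U: "open U" "Y \<subseteq> U" "emeasure \<mu> U \<noteq> \<infinity>" "measure \<mu> U < measure \<mu> Y + e / 4"
    using open_superset_measure[OF Yb, of "e / 4"] e by auto
  obtain P where P: "open P" "0 \<in> P" "\<And>h. h \<in> P \<Longrightarrow> (+) h ` Y \<subseteq> U"
    using small_translates[OF Y(1) U(1,2)] by blast
  have "open (w M -` P)" by (intro open_vimage P(1) w(1))
  then have "0 < emeasure \<mu> (w M -` P)"
    by (rule emeasure_open_pos[of _ 0]) (simp add: w(2) P(2))
  \<comment> \<open>Because \<open>w M 0 = 0\<close>, the elements \<open>y\<close> that translate
    \<open>Y\<close> into \<open>U\<close> include a neighbourhood of 0; \<open>V\<close> is a
    compact set of such \<open>y\<close> with positive measure.\<close>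
  then obtain V where V: "compact V" "V \<subseteq> w M -` P" "0 < emeasure \<mu> V"
    using compact_subset_open[OF \<open>open (w M -` P)\<close>] by blast
  have "\<exists>g\<in>{g \<in> Y. L g \<le> M}. emeasure \<mu> {y \<in> V. w M y + g \<in> Y} \<noteq> 0"
  proof (rule section_not_null[OF Y(1) V(1,3) w(1)[of M] _ e thick U])
    show "(+) (w M y) ` Y \<subseteq> U" if "y \<in> V" for y
      by (rule P(3)) (use V(2) that in blast)
  qed auto
  then obtain g where g: "g \<in> Y" "L g \<le> M" "emeasure \<mu> {y \<in> V. w M y + g \<in> Y} \<noteq> 0"
    by blast
  obtain Z where Z: "Z \<in> null_sets \<mu>" "N \<inter> V \<subseteq> Z"
    using N V(1) by (auto simp: locally_null_def)
  \<comment> \<open>Removing a null cover of the part of \<open>N\<close> in \<open>V\<close> makes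
    the remaining \<open>y\<close> generic without losing measure.\<close>
  define F where "F = {y \<in> V. w M y + g \<in> Y} - Z"
  have "closed ((\<lambda>y. w M y + g) -` Y)"
    by (intro closed_vimage compact_imp_closed Y(1) continuous_intros w(1))
  then have "V \<inter> (\<lambda>y. w M y + g) -` Y \<in> sets borel"
    by (intro sets.Int borel_closed borel_compact[OF V(1)])
  moreover have "{y \<in> V. w M y + g \<in> Y} = V \<inter> (\<lambda>y. w M y + g) -` Y" by blast
  ultimately have Gb: "{y \<in> V. w M y + g \<in> Y} \<in> sets \<mu>" by simp
  then have "emeasure \<mu> F = emeasure \<mu> {y \<in> V. w M y + g \<in> Y}"
    unfolding F_def by (rule emeasure_Diff_null_set[OF Z(1)])
  moreover have "F \<in> sets borel" using Gb Z(1) by (auto simp: F_def null_sets_def)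
  moreover have "F \<subseteq> V" by (auto simp: F_def)
  ultimately obtain Y' where Y': "compact Y'" "Y' \<subseteq> F" "0 < emeasure \<mu> Y'"
    using compact_subset_borel[of F V] V(1) g(3) by (auto simp: zero_less_iff_neq_zero)
  then have "Y' \<inter> N = {}" "\<forall>y\<in>Y'. w M y + g \<in> Y" using Z(2) by (auto simp: F_def)
  then show ?thesis using Y' g(2) by blast
qed

end

text \<open>
  Composing the maps of the successive steps gives nested compact sets, and \<open>L\<close> would be
  unbounded at a common point.
\<close>

lemma infinite_descent_compact:
  fixes L :: "'a::t2_space \<Rightarrow> nat" and Good :: "'a set \<Rightarrow> bool"
  assumes start: "Good Y0" and good: "\<And>Y. Good Y \<Longrightarrow> compact Y \<and> Y \<noteq> {}"
    and step: "\<And>Y. Good Y \<Longrightarrow> \<exists>f Y'. Good Y' \<and> continuous_on UNIV f \<and> f ` Y' \<subseteq> Y \<and> (\<forall>y\<in>Y'. L y < L (f y))"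
  shows False
proof -
  obtain F G where FG: "\<And>Y. Good Y \<Longrightarrow> Good (G Y)" "\<And>Y. Good Y \<Longrightarrow> continuous_on UNIV (F Y)"
      "\<And>Y. Good Y \<Longrightarrow> F Y ` G Y \<subseteq> Y" "\<And>Y y. \<lbrakk>Good Y; y \<in> G Y\<rbrakk> \<Longrightarrow> L y < L (F Y y)"
    using step by metis
  define Ys where "Ys n = (G ^^ n) Y0" for n
  \<comment> \<open>\<open>h n\<close> maps \<open>Ys n\<close> back into \<open>Y0\<close> by
    composing the first \<open>n\<close> maps, each of which raises \<open>L\<close> by at least
    1.\<close>
  define h where "h = rec_nat id (\<lambda>n f. f \<circ> F (Ys n))"
  have h0: "h 0 = id" and hS: "h (Suc n) = h n \<circ> F (Ys n)" for n by (auto simp: h_def)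
  have Good: "Good (Ys n)" for n
    by (induction n) (auto simp: Ys_def start FG(1))
  have YsS: "Ys (Suc n) = G (Ys n)" for n by (simp add: Ys_def)
  have cont: "continuous_on UNIV (h n)" for n
  proof (induction n)
    case (Suc n)
    show ?case unfolding hS
      by (intro continuous_on_compose FG(2) Good continuous_on_subset[OF Suc]) simp
  qed (simp add: h0 continuous_on_id)
  have grow: "n \<le> L (h n y)" if "y \<in> Ys n" for n y
  proof -
    have "y \<in> Ys n \<Longrightarrow> L y + n \<le> L (h n y)"
    proof (induction n arbitrary: y)
      case (Suc n)
      then have "F (Ys n) y \<in> Ys n" "L y < L (F (Ys n) y)"
        using FG(3)[OF Good, of n] FG(4)[OF Good[of n]] by (auto simp: YsS)
      then show ?case using Suc.IH[of "F (Ys n) y"] by (simp add: hS)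
    qed (simp add: h0)
    then show "n \<le> L (h n y)" using that by fastforce
  qed
  define Z where "Z n = h n ` Ys n" for n
  have Z: "compact (Z n)" "Z n \<noteq> {}" for n
    unfolding Z_def using good[OF Good, of n] cont[of n]
    by (auto intro!: compact_continuous_image continuous_on_subset[of UNIV])
  have "Z (Suc n) \<subseteq> Z n" for n
    unfolding Z_def hS YsS using FG(3)[OF Good, of n] by auto
  then have dec: "m \<le> n \<Longrightarrow> Z n \<subseteq> Z m" for m n
    by (rule lift_Suc_antimono_le)
  have "Z 0 \<inter> (\<Inter>n\<in>UNIV. Z n) \<noteq> {}"
  proof (rule compact_imp_fip_image)
    fix I' :: "nat set" assume I': "finite I'"
    have "Z (Max (insert 0 I')) \<subseteq> Z 0 \<inter> (\<Inter>n\<in>I'. Z n)"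
      using I' by (intro Int_greatest INT_greatest dec) auto
    then show "Z 0 \<inter> (\<Inter>n\<in>I'. Z n) \<noteq> {}" using Z(2) by blast
  qed (use Z compact_imp_closed in auto)
  then obtain x where x: "\<And>n. x \<in> Z n" by blast
  obtain y where "y \<in> Ys (Suc (L x))" "x = h (Suc (L x)) y" using x[of "Suc (L x)"] by (auto simp: Z_def)
  then show False using grow[of y "Suc (L x)"] by simp
qed

section \<open>Actions on trees\<close>

lemma continuous_on_psum:
  fixes t :: "'a::topological_space \<Rightarrow> 'g::topological_group_add"
  assumes "continuous_on S t"
  shows "continuous_on S (\<lambda>x. psum (\<lambda>_. t x) n)"
  by (induction n) (auto intro!: continuous_intros assms)

lemma psum_zero [simp]: "psum (\<lambda>_. 0) n = 0"
  by (induction n) auto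

lemma commutator_product_zero [simp]: "commutator_product a b 0 = 0"
  by (simp add: commutator_product_def)

lemma continuous_on_commutator_product:
  fixes a b :: "'g::topological_group_add"
  shows "continuous_on S (commutator_product a b)"
  unfolding commutator_product_def by (intro continuous_intros)

locale haar_tree_action = haar_group \<mu> + tree_action V d act
  for \<mu> :: "'g::{topological_group_add, t2_space} measure"
    and V :: "'v set" and d :: "'v \<Rightarrow> 'v \<Rightarrow> nat" and act :: "'g \<Rightarrow> 'v \<Rightarrow> 'v"
begin

text \<open>A nonempty transporter is a left coset of the stabiliser.\<close>

lemma locally_null_transporter:
  assumes null: "locally_null {g. act g x = x}" and x: "x \<in> V"
  shows "locally_null {g. act g x = x'}"
proof (cases "\<exists>g. act g x = x'")
  case True
  then obtain h where h: "act h x = x'" by blast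
  have "{g. act g x = x'} \<subseteq> (+) h ` {g. act g x = x}"
  proof
    fix g assume "g \<in> {g. act g x = x'}"
    then have "act (- h + g) x = act (- h) (act h x)" using h x by (simp add: act_plus)
    then have "act (- h + g) x = x" using x by simp
    then show "g \<in> (+) h ` {g. act g x = x}"
      by (intro image_eqI[of _ _ "- h + g"]) (auto simp: add.assoc[symmetric])
  qed
  then show ?thesis using locally_null_subset[OF locally_null_translate[OF null]] by blast
qed simp

lemma locally_null_meeting:
  assumes null: "\<And>x. x \<in> V \<Longrightarrow> locally_null {g. act g x = x}" and S: "countable S" "S \<subseteq> V"
  shows "locally_null {y. act y ` S \<inter> S \<noteq> {}}"
proof -
  have "locally_null (\<Union>x'\<in>S. {y. act y x = x'})" if "x \<in> S" for x
    by (rule locally_null_UN[OF S(1)], rule locally_null_transporter[OF null]) (use S(2) that in blast)+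
  then have "locally_null (\<Union>x\<in>S. \<Union>x'\<in>S. {y. act y x = x'})"
    by (rule locally_null_UN[OF S(1)])
  moreover have "{y. act y ` S \<inter> S \<noteq> {}} \<subseteq> (\<Union>x\<in>S. \<Union>x'\<in>S. {y. act y x = x'})"
    by auto
  ultimately show ?thesis by (rule locally_null_subset)
qed

lemma null_stabilisers_absurd:
  assumes null: "\<And>x. x \<in> V \<Longrightarrow> locally_null {g. act g x = x}" and v0: "v0 \<in> V"
  shows False
proof -
  have generic: "\<exists>y. act y ` S \<inter> S = {}" if "countable S" "S \<subseteq> V" for S
  proof (rule ccontr)
    assume "\<not> ?thesis"
    then have "{y. act y ` S \<inter> S \<noteq> {}} = UNIV" by blast
    then show False using locally_null_meeting[OF null that] not_locally_null_UNIV by simp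
  qed
  have "\<exists>a. Fix a = {}"
  proof (rule ccontr)
    assume "\<not> ?thesis"
    then obtain p :: "nat \<Rightarrow> 'v" where p: "range p \<subseteq> V" "\<And>g. \<exists>n. act g (p n) = p n"
      using countably_many_stabilisers_cover[OF _ v0] by blast
    have "locally_null (\<Union>n. {g. act g (p n) = p n})"
      by (rule locally_null_UN) (use p null in auto)
    moreover have "(\<Union>n. {g. act g (p n) = p n}) = UNIV" using p(2) by blast
    ultimately show False using not_locally_null_UNIV by simp
  qed
  then obtain a where a: "Fix a = {}" by blast
  \<comment> \<open>\<open>S0\<close> serves to choose \<open>b\<close> and the base vertex
    \<open>v\<close>; the final subtree \<open>S\<close> must contain \<open>v\<close> and be
    invariant under \<open>b\<close> as well.\<close>
  obtain S0 where S0: "convex_in S0" "countable S0" "v0 \<in> S0" "\<And>g. g \<in> {a, - a} \<Longrightarrow> act g ` S0 \<subseteq> S0"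
    using countable_invariant_convex[OF v0, of "{a, - a}"] by auto
  have "S0 \<subseteq> V" using S0(1) by (simp add: convex_in_def)
  then obtain y0 where y0: "act y0 ` S0 \<inter> S0 = {}"
    using generic[OF S0(2)] by blast
  define b where "b = y0 + a + - y0"
  have "S0 \<noteq> {}" using S0(3) by blast
  then have "Fix b = {} \<and> (\<exists>v\<in>V. \<forall>q\<in>V. 2 * d q v \<le> d q (act a q) + d q (act b q))"
    unfolding b_def using S0(4) by (intro conjugate_pair[OF S0(1) _ _ _ a y0]) auto
  then obtain v where b: "Fix b = {}" and v: "v \<in> V"
    and displ: "\<And>q. q \<in> V \<Longrightarrow> 2 * d q v \<le> d q (act a q) + d q (act b q)"
    by blast
  have "\<exists>S. convex_in S \<and> countable S \<and> v \<in> S \<and> (\<forall>g\<in>{a, - a, b, - b}. act g ` S \<subseteq> S)"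
    by (rule countable_invariant_convex[OF v]) simp
  then obtain S where S: "convex_in S" "countable S" "v \<in> S" "\<forall>g\<in>{a, - a, b, - b}. act g ` S \<subseteq> S"
    by blast
  have S_inv: "act a ` S \<subseteq> S" "act (- a) ` S \<subseteq> S" "act b ` S \<subseteq> S" "act (- b) ` S \<subseteq> S"
    using S(4) by simp_all
  define N where "N = {y. act y ` S \<inter> S \<noteq> {}}"
  have N: "locally_null N"
    unfolding N_def by (rule locally_null_meeting[OF null S(2)]) (use S(1) in \<open>auto simp: convex_in_def\<close>)
  define L where "L g = d v (act g v)" for g
  \<comment> \<open>The power from \<open>commutator_product_growth\<close>; it is continuous and
    vanishes at 0, as \<open>dudley_step\<close> requires.\<close>
  define w where "w M y = psum (\<lambda>_. commutator_product a b y) (M + 3)" for M y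
  have w: "continuous_on UNIV (w M)" "w M 0 = 0" for M
    unfolding w_def
    by (rule continuous_on_psum[OF continuous_on_commutator_product]) simp
  define Good where "Good Y \<longleftrightarrow> compact Y \<and> 0 < emeasure \<mu> Y" for Y
  obtain Y0 where "compact Y0" "0 < emeasure \<mu> Y0"
    using compact_subset_open[OF open_UNIV emeasure_UNIV_pos] by blast
  then have start: "Good Y0" by (simp add: Good_def)
  have good: "compact Y \<and> Y \<noteq> {}" if "Good Y" for Y
    using that by (auto simp: Good_def)
  \<comment> \<open>Passing from \<open>y\<close> to \<open>w M y + g\<close> increases the
    displacement of \<open>v\<close>, because \<open>y\<close> avoids \<open>N\<close> and so moves
    \<open>S\<close> off itself.\<close>
  have step: "\<exists>f Y'. Good Y' \<and> continuous_on UNIV f \<and> f ` Y' \<subseteq> Y \<and> (\<forall>y\<in>Y'. L y < L (f y))"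
    if Y: "Good Y" for Y
  proof -
    obtain M g Y' where Y': "L g \<le> M" "Good Y'" "Y' \<inter> N = {}" "\<And>y. y \<in> Y' \<Longrightarrow> w M y + g \<in> Y"
      using dudley_step[of Y N w L] Y N w unfolding Good_def by blast
    have "L y < L (w M y + g)" if "y \<in> Y'" for y
    proof -
      have "act y ` S \<inter> S = {}" using Y'(3) that by (auto simp: N_def)
      then show ?thesis
        unfolding L_def w_def
        by (rule commutator_product_growth[OF S(1,3) _ S_inv a b displ])
           (use Y'(1) in \<open>simp_all add: L_def\<close>)
    qed
    moreover have "continuous_on UNIV (\<lambda>y. w M y + g)"
      by (intro continuous_intros w(1))
    ultimately show ?thesis using Y' by (intro exI[of _ "\<lambda>y. w M y + g"] exI[of _ Y']) auto
  qed
  show False by (rule infinite_descent_compact[OF start good step])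
qed

section \<open>Open stabilisers and finite orbits\<close>

lemma orbit_map_locally_constant:
  assumes v: "v \<in> V" and K: "compact K" "0 < emeasure \<mu> K" "K \<subseteq> {g. act g v = v}"
  shows "open {g. act g v = x}"
proof -
  obtain P where P: "open P" "0 \<in> P" "\<And>h. h \<in> P \<Longrightarrow> (+) h ` K \<inter> K \<noteq> {}"
    using steinhaus[OF K(1,2)] by blast
  \<comment> \<open>By Steinhaus, \<open>h\<close> carries some element of \<open>K\<close> into
    \<open>K\<close>; both elements fix \<open>v\<close>, hence so does \<open>h\<close>.\<close>
  have P_fix: "act h v = v" if h: "h \<in> P" for h
  proof -
    obtain k where k: "k \<in> K" "h + k \<in> K" using P(3)[OF h] by blast
    then have "act (h + k) v = v" "act k v = v" using K(3) by auto
    then show ?thesis using act_plus[OF v, of h k] by simp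
  qed
  show ?thesis
  proof (subst open_subopen, intro ballI)
    fix g assume "g \<in> {g. act g v = x}"
    then have "(+) g ` P \<subseteq> {g. act g v = x}" using P_fix act_plus[OF v] by auto
    moreover have "g \<in> (+) g ` P" using P(2) by force
    ultimately show "\<exists>T. open T \<and> g \<in> T \<and> T \<subseteq> {g. act g v = x}"
      using open_translate[OF P(1)] by blast
  qed
qed

text \<open>The connected identity component cannot leave the open and closed stabiliser of
  \<open>v\<close>, so the orbit map factors through the compact coset space, and there it has open
  fibres.\<close>

lemma finite_orbit:
  assumes ac: "almost_connected TYPE('g)" and v: "v \<in> V" and op: "\<And>x. open {g. act g v = x}"
  shows "finite (range (\<lambda>g. act g v))"
proof -
  define C0 where "C0 = (identity_component :: 'g set)"
  have "connected C0" and zero: "0 \<in> C0"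
    unfolding C0_def identity_component_def by auto
  have C0: "act c v = v" if c: "c \<in> C0" for c
  proof (rule ccontr)
    assume ne: "act c v \<noteq> v"
    have "open (\<Union>x\<in>- {v}. {g. act g v = x})" using op by blast
    moreover have "(\<Union>x\<in>- {v}. {g. act g v = x}) = {g. act g v \<noteq> v}" by blast
    ultimately have "open {g. act g v \<noteq> v}" by simp
    then have "{g. act g v = v} \<inter> C0 = {} \<or> {g. act g v \<noteq> v} \<inter> C0 = {}"
      by (intro connectedD[OF \<open>connected C0\<close> op]) auto
    moreover have "0 \<in> {g. act g v = v} \<inter> C0" "c \<in> {g. act g v \<noteq> v} \<inter> C0"
      using zero c ne v by simp_all
    ultimately show False by blast
  qed
  \<comment> \<open>The fibres of the induced map on cosets; \<open>U_iff\<close> says that this map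
    is well defined.\<close>
  define U where "U x = {(+) g ` C0 | g. act g v = x}" for x
  have U_iff: "(+) g ` C0 \<in> U x \<longleftrightarrow> act g v = x" for g x
  proof
    assume "(+) g ` C0 \<in> U x"
    then obtain g' where g': "(+) g ` C0 = (+) g' ` C0" "act g' v = x" by (auto simp: U_def)
    have "g \<in> (+) g ` C0" using zero by force
    then obtain c where "c \<in> C0" "g = g' + c" using g'(1) by auto
    then show "act g v = x" using C0 g'(2) act_plus[OF v] by simp
  qed (auto simp: U_def)
  have opU: "openin (coset_topology C0) (U x)" for x
    unfolding openin_coset_topology U_iff using op by (auto simp: U_def left_cosets_def)
  have comp: "compactin (coset_topology C0) (left_cosets C0)"
    using ac by (simp add: almost_connected_def C0_def compact_space_def topspace_coset_topology)
  have cover: "left_cosets C0 \<subseteq> \<Union> (U ` range (\<lambda>g. act g v))"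
    by (auto simp: left_cosets_def U_def)
  obtain \<F> where F: "finite \<F>" "\<F> \<subseteq> U ` range (\<lambda>g. act g v)" "left_cosets C0 \<subseteq> \<Union>\<F>"
    using compactinD[OF comp _ cover] opU by blast
  then obtain Q where Q: "finite Q" "\<F> = U ` Q" using finite_subset_image by metis
  have "range (\<lambda>g. act g v) \<subseteq> Q"
  proof
    fix x assume "x \<in> range (\<lambda>g. act g v)"
    then obtain g where g: "x = act g v" by blast
    have "(+) g ` C0 \<in> \<Union>\<F>" using F(3) by (auto simp: left_cosets_def)
    then obtain x' where "x' \<in> Q" "(+) g ` C0 \<in> U x'" using Q(2) by blast
    then show "x \<in> Q" using U_iff g by simp
  qed
  then show ?thesis using Q(1) finite_subset by blast
qed

lemma fixed_vertex:
  assumes ac: "almost_connected TYPE('g)" and ne: "V \<noteq> {}"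
    and meas: "\<And>x. x \<in> V \<Longrightarrow> haar_measurable \<mu> {g. act g x = x}"
    and no_inversion: "\<And>g x. x \<in> V \<Longrightarrow> d x (act g x) \<noteq> 1"
  shows "\<exists>x\<in>V. \<forall>g. act g x = x"
proof -
  obtain v0 where "v0 \<in> V" using ne by blast
  then obtain v where v: "v \<in> V" "\<not> locally_null {g. act g v = v}"
    using null_stabilisers_absurd by blast
  then obtain K where K: "compact K" "K \<subseteq> {g. act g v = v}" "0 < emeasure \<mu> K"
    using haar_measurable_dichotomy[OF meas[OF v(1)]] by blast
  show ?thesis
  proof (rule finite_orbit_imp_fixed_vertex)
    show "finite (range (\<lambda>g. act g v))"
      by (rule finite_orbit[OF ac v(1) orbit_map_locally_constant[OF v(1) K(1,3,2)]])
    show "act g ` range (\<lambda>h. act h v) \<subseteq> range (\<lambda>h. act h v)" for g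
      using act_plus[OF v(1), symmetric] by auto
  qed (use v(1) no_inversion in auto)
qed

end

theorem theorem4:
  fixes \<mu> :: "'g::{topological_group_add, t2_space} measure"
    and V :: "'v set" and E :: "'v set set"
    and act :: "'g \<Rightarrow> 'v \<Rightarrow> 'v"
  assumes "locally_compact_space (euclidean :: 'g topology)"
    and "almost_connected TYPE('g)"
    and "left_haar_measure \<mu>"
    and "simplicial_tree V E"
    and "simplicial_action V E act"
    and "type_preserving V E act"
    and "measurable_action \<mu> V E act"
  shows "\<exists>p\<in>geometric_realisation V E. \<forall>g. realisation_action V act g p = p"
proof -
  from assms(6) obtain A B where "bipartition V E A B \<and> (\<forall>g. act g ` A = A \<and> act g ` B = B)"
    unfolding type_preserving_def by (elim exE)
  then have AB: "bipartition V E A B" "\<And>g. act g ` A = A" "\<And>g. act g ` B = B"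
    by simp_all
  interpret tree_action V "graph_dist E" act
    by (rule tree_action_graph_dist[OF assms(4) AB(1) assms(5)])
  interpret haar_tree_action \<mu> V "graph_dist E" act
    by unfold_locales (rule assms(3))
  have "\<exists>x\<in>V. \<forall>g. act g x = x"
  proof (rule fixed_vertex[OF assms(2)])
    show "V \<noteq> {}" using assms(4) by (simp add: simplicial_tree_def)
    show "haar_measurable \<mu> {g. act g x = x}" if "x \<in> V" for x
      using assms(7) that by (simp add: measurable_action_def)
    show "graph_dist E x (act g x) \<noteq> 1" if "x \<in> V" for g x
      using graph_dist_act_neq_1[OF assms(4) AB that] that by simp
  qed
  then obtain x where x: "x \<in> V" "\<And>g. act g x = x" by blast
  \<comment> \<open>The barycentric coordinates of the fixed vertex.\<close>
  define p :: "'v \<Rightarrow> real" where "p w = (if w = x then 1 else 0)" for w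
  have "{w. p w \<noteq> 0} = {x}" by (auto simp: p_def)
  then have "p \<in> geometric_realisation V E"
    using x(1) by (auto simp: geometric_realisation_def simplices_def p_def)
  moreover have "realisation_action V act g p = p" for g
  proof
    fix w
    have "act (- g) w = x \<longleftrightarrow> w = x" if "w \<in> V"
      using act_uminus(2)[OF that, of g] x(2) by metis
    then show "realisation_action V act g p w = p w"
      using x(1) by (auto simp: realisation_action_def p_def)
  qed
  ultimately show ?thesis by blast
qed

end
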